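(* Let $\mathcal{S}_3$ be the algebra of polynomial functions on the space $M_3^0(\mathbb{C})$ of traceless complex $3\times 3$ matrices that are invariant under the conjugation action $x\mapsto axa^{-1}$ of $\mathrm{SO}_3(\mathbb{C})$. For $x\in M_3^0(\mathbb{C})$ with transpose $x'$ define $$E_1=\operatorname{tr}(x^2),\quad E_2=\operatorname{tr}(xx'),\quad E_3=\operatorname{tr}(x^3),\quad E_4=\operatorname{tr}(x^2x'),\quad E_5=\operatorname{tr}(x^2(x')^2),\quad E_6=\operatorname{tr}(xx'x^2(x')^2),$$ and let $\mathcal{S}_3^\dagger$ be the subalgebra of $\mathcal{S}_3$ generated by $E_1,\ldots,E_5$. Then the invariants $E_1,\ldots,E_5$ form a homogeneous system of parameters of the algebra $\mathcal{S}_3$, and the identity element $1$ and $E_6$ form a free basis of $\mathcal{S}_3$ as an $\mathcal{S}_3^\dagger$-module.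
   Context: $\mathrm{SO}_3(\mathbb{C})=\{a\in M_3(\mathbb{C}): aa'=I_3,\ \det a=1\}$, where $a'$ denotes the transpose. The algebra $\mathcal{S}_3$ is graded by the degree of polynomials. A homogeneous system of parameters of $\mathcal{S}_3$ is an algebraically independent (over $\mathbb{C}$) set of homogeneous polynomials $\{f_1,\ldots,f_m\}\subseteq\mathcal{S}_3$ such that $\mathcal{S}_3$ is integral over the polynomial algebra $\mathbb{C}[f_1,\ldots,f_m]$. *)

theory Defs
  imports
    "HOL-Analysis.Analysis"
    "HOL-Library.Poly_Mapping"
    "HOL-Library.Function_Algebras"
    "HOL-Computational_Algebra.Polynomial"
begin

section \<open>Multivariate polynomials over the complex numbers\<close>

text \<open>Variables are indexed by \<open>'v\<close>; a monomial is a finitely supported exponent vector.\<close>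

type_synonym 'v mpoly = "('v \<Rightarrow>\<^sub>0 nat) \<Rightarrow>\<^sub>0 complex"

definition meval :: "('v \<Rightarrow> complex) \<Rightarrow> 'v mpoly \<Rightarrow> complex" where
  "meval v p =
     (\<Sum>m\<in>Poly_Mapping.keys p. Poly_Mapping.lookup p m *
        (\<Prod>i\<in>Poly_Mapping.keys m. v i ^ Poly_Mapping.lookup m i))"

definition mvars :: "'v mpoly \<Rightarrow> 'v set" where
  "mvars p = (\<Union>m\<in>Poly_Mapping.keys p. Poly_Mapping.keys m)"

definition mdegree :: "('v \<Rightarrow>\<^sub>0 nat) \<Rightarrow> nat" where
  "mdegree m = (\<Sum>i\<in>Poly_Mapping.keys m. Poly_Mapping.lookup m i)"

definition mhomogeneous :: "nat \<Rightarrow> 'v mpoly \<Rightarrow> bool" where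
  "mhomogeneous d p \<longleftrightarrow> (\<forall>m\<in>Poly_Mapping.keys p. mdegree m = d)"


section \<open>Algebras of complex-valued functions\<close>

text \<open>Functions \<open>'x \<Rightarrow> complex\<close> form a commutative ring under the pointwise operations of
  \<^theory>\<open>HOL-Library.Function_Algebras\<close>; a complex scalar acts as the constant function.\<close>

definition is_subalgebra :: "('x \<Rightarrow> complex) set \<Rightarrow> bool" where
  "is_subalgebra B \<longleftrightarrow>
     (\<forall>c. (\<lambda>_. c) \<in> B) \<and> (\<forall>f\<in>B. \<forall>g\<in>B. f + g \<in> B) \<and> (\<forall>f\<in>B. \<forall>g\<in>B. f * g \<in> B)"

definition generated_subalgebra :: "('x \<Rightarrow> complex) set \<Rightarrow> ('x \<Rightarrow> complex) set" where
  "generated_subalgebra X = is_subalgebra hull X"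

definition algebraically_independent :: "('x \<Rightarrow> complex) list \<Rightarrow> bool" where
  "algebraically_independent fs \<longleftrightarrow>
     (\<forall>p :: nat mpoly. mvars p \<subseteq> {..<length fs} \<longrightarrow>
        (\<forall>x. meval (\<lambda>i. (fs ! i) x) p = 0) \<longrightarrow> p = 0)"

definition integral_over :: "('x \<Rightarrow> complex) set \<Rightarrow> ('x \<Rightarrow> complex) \<Rightarrow> bool" where
  "integral_over B f \<longleftrightarrow>
     (\<exists>p :: ('x \<Rightarrow> complex) poly. lead_coeff p = 1 \<and> (\<forall>i. coeff p i \<in> B) \<and> poly p f = 0)"

text \<open>The list \<open>bs\<close> is a free basis of \<open>M\<close> as a module over \<open>B\<close>, where \<open>B\<close> acts by
  multiplication of functions.\<close>

definition free_module_basis ::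
    "('x \<Rightarrow> complex) set \<Rightarrow> ('x \<Rightarrow> complex) set \<Rightarrow> ('x \<Rightarrow> complex) list \<Rightarrow> bool" where
  "free_module_basis B M bs \<longleftrightarrow>
     M = {\<Sum>i<length bs. c i * bs ! i | c. \<forall>i<length bs. c i \<in> B} \<and>
     (\<forall>c. (\<forall>i<length bs. c i \<in> B) \<longrightarrow> (\<Sum>i<length bs. c i * bs ! i) = 0 \<longrightarrow>
        (\<forall>i<length bs. c i = 0))"


section \<open>Traceless matrices and polynomial functions on them\<close>

typedef traceless = "{x :: complex^3^3. trace x = 0}"
  morphisms mat_of Traceless
  by (rule exI[of _ 0]) (simp add: trace_def)

definition poly_function :: "(traceless \<Rightarrow> complex) \<Rightarrow> bool" where
  "poly_function f \<longleftrightarrow>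
     (\<exists>p :: (3 \<times> 3) mpoly. \<forall>x. f x = meval (\<lambda>(i, j). mat_of x $ i $ j) p)"

definition homogeneous_poly_function :: "nat \<Rightarrow> (traceless \<Rightarrow> complex) \<Rightarrow> bool" where
  "homogeneous_poly_function d f \<longleftrightarrow>
     (\<exists>p :: (3 \<times> 3) mpoly. mhomogeneous d p \<and>
        (\<forall>x. f x = meval (\<lambda>(i, j). mat_of x $ i $ j) p))"

definition SO3 :: "(complex^3^3) set" where
  "SO3 = {a. a ** transpose a = mat 1 \<and> det a = 1}"

definition conj_by :: "complex^3^3 \<Rightarrow> traceless \<Rightarrow> traceless" where
  "conj_by a x = Traceless (a ** mat_of x ** matrix_inv a)"

lemma mat_of_conj_by:
  assumes "a \<in> SO3"
  shows "mat_of (conj_by a x) = a ** mat_of x ** matrix_inv a"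
proof -
  have "invertible a"
    using assms by (auto simp: SO3_def invertible_right_inverse)
  then have "matrix_inv a ** a = mat 1"
    unfolding invertible_def matrix_inv_def by (rule someI2_ex) blast
  then have "trace (a ** mat_of x ** matrix_inv a) = trace (mat_of x)"
    by (metis matrix_mul_assoc matrix_mul_lid trace_mul_sym)
  then show ?thesis
    using mat_of[of x] by (simp add: conj_by_def Traceless_inverse)
qed

definition S3 :: "(traceless \<Rightarrow> complex) set" where
  "S3 = {f. poly_function f \<and> (\<forall>a\<in>SO3. \<forall>x. f (conj_by a x) = f x)}"

definition homogeneous_system_of_parameters ::
    "(traceless \<Rightarrow> complex) set \<Rightarrow> (traceless \<Rightarrow> complex) list \<Rightarrow> bool" where
  "homogeneous_system_of_parameters A fs \<longleftrightarrow>
     set fs \<subseteq> A \<and>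
     (\<forall>f\<in>set fs. \<exists>d. homogeneous_poly_function d f) \<and>
     algebraically_independent fs \<and>
     (\<forall>g\<in>A. integral_over (generated_subalgebra (set fs)) g)"


section \<open>The invariants\<close>

definition E1 :: "traceless \<Rightarrow> complex" where
  "E1 X = (let x = mat_of X in trace (x ** x))"

definition E2 :: "traceless \<Rightarrow> complex" where
  "E2 X = (let x = mat_of X; x' = transpose x in trace (x ** x'))"

definition E3 :: "traceless \<Rightarrow> complex" where
  "E3 X = (let x = mat_of X in trace (x ** x ** x))"

definition E4 :: "traceless \<Rightarrow> complex" where
  "E4 X = (let x = mat_of X; x' = transpose x in trace (x ** x ** x'))"

definition E5 :: "traceless \<Rightarrow> complex" where
  "E5 X = (let x = mat_of X; x' = transpose x in trace (x ** x ** x' ** x'))"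

definition E6 :: "traceless \<Rightarrow> complex" where
  "E6 X = (let x = mat_of X; x' = transpose x in trace (x ** x' ** x ** x ** x' ** x'))"

definition S3_dagger :: "(traceless \<Rightarrow> complex) set" where
  "S3_dagger = generated_subalgebra {E1, E2, E3, E4, E5}"

end

theory Submission
  imports Defs
begin

text \<open>
  Write a traceless matrix as the sum of a symmetric matrix \<open>s\<close> and of the skew matrix \<open>v \<mapsto> u \<times> v\<close>
  with axis \<open>u\<close>. Then \<open>E1, \<dots>, E5\<close> carry the same information as the invariants \<open>tr s\<^sup>2\<close>, \<open>tr s\<^sup>3\<close>,
  \<open>u \<bullet> u\<close>, \<open>u \<bullet> s u\<close>, \<open>u \<bullet> s\<^sup>2 u\<close>, and \<open>E6\<close> is, up to a polynomial in these and a non-zero factor, the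
  determinant of \<open>u, s u, s\<^sup>2 u\<close>, which changes sign with \<open>u\<close>.

  The main point is that every invariant \<open>f\<close> has the form \<open>A + B E6\<close> with \<open>A, B\<close> in the algebra
  generated by \<open>E1, \<dots>, E5\<close> (lemma \<open>S3_decomp\<close>). If \<open>u \<bullet> u \<noteq> 0\<close>, the matrix is conjugate to one with
  axis \<open>\<rho> e\<^sub>3\<close>, so \<open>f\<close> is determined by its restriction to the slice of these matrices. This
  restriction is a polynomial invariant under the rotations about \<open>e\<^sub>3\<close> and under a half-turn that
  reverses the axis; averaging over roots of unity and over the half-turn determines all such
  polynomials (lemma \<open>S3_slice_form\<close>). Expressing the result by \<open>E1, \<dots>, E6\<close> introduces only
  powers of \<open>h = u \<bullet> u = (E2 - E1) / 4\<close> as denominators, so \<open>h ^ j f = A + B E6\<close> for some \<open>j\<close>.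

  A factor \<open>h\<close> is then cancelled (lemma \<open>axis_norm_cancel\<close>): where \<open>h = 0\<close> and \<open>j > 0\<close>, one has
  \<open>A + B E6 = 0\<close>. An explicit family of matrices with isotropic axis attains generic values of
  \<open>E1, E3, E4, E5\<close>, each at two points where \<open>E6\<close> differs. Hence \<open>A\<close> and \<open>B\<close> vanish identically as
  polynomials in \<open>E1, E3, E4, E5\<close> after reduction modulo \<open>h\<close>, that is, they are divisible by \<open>h\<close>.

  The rest follows: on the slice \<open>E1, \<dots>, E5\<close> attain all values with \<open>h \<noteq> 0\<close> and generic slice
  coordinates, whence their algebraic independence; replacing \<open>\<rho>\<close> by \<open>- \<rho>\<close> keeps them fixed and changes
  \<open>E6\<close>, whence the independence of \<open>1\<close> and \<open>E6\<close>; and integrality holds since \<open>E6\<^sup>2\<close> is itself of the form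
  \<open>C + D E6\<close>, so that \<open>A + B E6\<close> is a root of a monic quadratic polynomial.
\<close>

section \<open>Subalgebras generated by a set of functions\<close>

abbreviation alg :: "('x \<Rightarrow> complex) set \<Rightarrow> ('x \<Rightarrow> complex) set" where
  "alg \<equiv> generated_subalgebra"

lemma is_subalgebra_alg: "is_subalgebra (alg X)"
  unfolding generated_subalgebra_def
proof (rule hull_in)
  fix T :: "('x \<Rightarrow> complex) set set"
  assume T: "Ball T is_subalgebra"
  show "is_subalgebra (\<Inter>T)"
    unfolding is_subalgebra_def
  proof (intro conjI allI ballI InterI)
    fix c t assume "t \<in> T"
    with T show "(\<lambda>_. c) \<in> t" by (auto simp: is_subalgebra_def)
  next
    fix f g t assume fg: "f \<in> \<Inter>T" "g \<in> \<Inter>T" and t: "t \<in> T"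
    have "f \<in> t" "g \<in> t" using fg t by (auto simp only: Inter_iff)
    moreover have "is_subalgebra t" using T t by (rule bspec)
    ultimately show "f + g \<in> t" "f * g \<in> t"
      unfolding is_subalgebra_def by blast+
  qed
qed

lemma alg_gen: "g \<in> X \<Longrightarrow> g \<in> alg X"
  unfolding generated_subalgebra_def by (rule hull_inc)

lemma alg_const: "(\<lambda>_. c) \<in> alg X"
  using is_subalgebra_alg[of X] by (auto simp: is_subalgebra_def)

lemma alg_add: "f \<in> alg X \<Longrightarrow> g \<in> alg X \<Longrightarrow> (\<lambda>x. f x + g x) \<in> alg X"
  using is_subalgebra_alg[of X] by (auto simp: is_subalgebra_def plus_fun_def)

lemma alg_mult: "f \<in> alg X \<Longrightarrow> g \<in> alg X \<Longrightarrow> (\<lambda>x. f x * g x) \<in> alg X"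
  using is_subalgebra_alg[of X] by (auto simp: is_subalgebra_def times_fun_def)

lemma alg_uminus: "f \<in> alg X \<Longrightarrow> (\<lambda>x. - f x) \<in> alg X"
  using alg_mult[OF alg_const[of "-1"], of f X] by simp

lemma alg_diff: "f \<in> alg X \<Longrightarrow> g \<in> alg X \<Longrightarrow> (\<lambda>x. f x - g x) \<in> alg X"
  using alg_add[OF _ alg_uminus, of f X g] by simp

lemma alg_power: "f \<in> alg X \<Longrightarrow> (\<lambda>x. f x ^ n) \<in> alg X"
  by (induction n) (auto intro: alg_const alg_mult)

lemma alg_divide_const: "f \<in> alg X \<Longrightarrow> (\<lambda>x. f x / c) \<in> alg X"
  using alg_mult[OF _ alg_const[of "1 / c"], of f X] by simp

lemma alg_sum:
  "finite S \<Longrightarrow> (\<And>s. s \<in> S \<Longrightarrow> f s \<in> alg X) \<Longrightarrow> (\<lambda>x. \<Sum>s\<in>S. f s x) \<in> alg X"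
  by (induction S rule: finite_induct) (auto intro: alg_const alg_add)

lemma alg_prod:
  "finite S \<Longrightarrow> (\<And>s. s \<in> S \<Longrightarrow> f s \<in> alg X) \<Longrightarrow> (\<lambda>x. \<Prod>s\<in>S. f s x) \<in> alg X"
  by (induction S rule: finite_induct) (auto intro: alg_const alg_mult)

lemmas alg_intros =
  alg_const alg_add alg_mult alg_uminus alg_diff alg_power alg_divide_const

lemma alg_induct [consumes 1, case_names gen const add mult]:
  assumes "f \<in> alg X"
    and "\<And>g. g \<in> X \<Longrightarrow> P g"
    and "\<And>c. P (\<lambda>_. c)"
    and "\<And>f g. f \<in> alg X \<Longrightarrow> g \<in> alg X \<Longrightarrow> P f \<Longrightarrow> P g \<Longrightarrow> P (\<lambda>x. f x + g x)"
    and "\<And>f g. f \<in> alg X \<Longrightarrow> g \<in> alg X \<Longrightarrow> P f \<Longrightarrow> P g \<Longrightarrow> P (\<lambda>x. f x * g x)"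
  shows "P f"
proof -
  let ?Q = "{f \<in> alg X. P f}"
  have "is_subalgebra ?Q"
    using assms is_subalgebra_alg[of X]
    by (auto simp: is_subalgebra_def plus_fun_def times_fun_def)
  then have "alg X \<subseteq> ?Q"
    using assms(2) alg_gen unfolding generated_subalgebra_def by (intro hull_minimal) auto
  then show ?thesis using assms(1) by blast
qed

lemma alg_subset: "X \<subseteq> alg Y \<Longrightarrow> alg X \<subseteq> alg Y"
  using is_subalgebra_alg[of Y] unfolding generated_subalgebra_def by (intro hull_minimal)

lemma alg_comp:
  assumes "f \<in> alg X" and "\<And>g. g \<in> X \<Longrightarrow> (\<lambda>y. g (\<phi> y)) \<in> alg Y"
  shows "(\<lambda>y. f (\<phi> y)) \<in> alg Y"
  using assms(1) by (induction rule: alg_induct) (auto intro: alg_intros assms(2))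

text \<open>The first \<open>n\<close> coordinate functions on complex sequences. The algebra that they generate consists
  of the polynomial functions in \<open>n\<close> variables; no dimension appears in a type, so the same notion
  serves for four, five and six variables.\<close>

definition coords :: "nat \<Rightarrow> ((nat \<Rightarrow> complex) \<Rightarrow> complex) set" where
  "coords n = (\<lambda>i c. c i) ` {..<n}"

lemma alg_coord: "i < n \<Longrightarrow> (\<lambda>c. c i) \<in> alg (coords n)"
  by (rule alg_gen) (auto simp: coords_def)

lemma alg_coords_cong:
  assumes "P \<in> alg (coords n)" and "\<And>i. i < n \<Longrightarrow> c i = d i"
  shows "P c = P d"
  using assms(1) by (induction rule: alg_induct) (auto simp: coords_def assms(2))

lemma alg_coords_comp:
  assumes "P \<in> alg (coords n)" and "\<And>i. i < n \<Longrightarrow> (\<lambda>y. \<phi> y i) \<in> alg Y"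
  shows "(\<lambda>y. P (\<phi> y)) \<in> alg Y"
  using assms(1) by (rule alg_comp) (auto simp: coords_def assms(2))

text \<open>Elements of a generated algebra are polynomials in the generators.\<close>

lemma alg_set_rep:
  assumes "f \<in> alg (set fs)" and n: "length fs = n"
  obtains P where "P \<in> alg (coords n)" "\<And>x. f x = P (\<lambda>i. (fs ! i) x)"
proof -
  have "\<exists>P \<in> alg (coords n). \<forall>x. f x = P (\<lambda>i. (fs ! i) x)"
    using assms(1)
  proof (induction rule: alg_induct)
    case (gen g)
    then obtain i where "i < length fs" "g = fs ! i" by (auto simp: in_set_conv_nth)
    then show ?case by (intro bexI[of _ "\<lambda>c. c i"]) (auto intro: alg_coord simp: n)
  next
    case (const c)
    show ?case by (intro bexI[of _ "\<lambda>_. c"]) (auto intro: alg_const)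
  next
    case (add f g)
    then obtain P Q where "P \<in> alg (coords n)" "Q \<in> alg (coords n)"
      "\<forall>x. f x = P (\<lambda>i. (fs ! i) x)" "\<forall>x. g x = Q (\<lambda>i. (fs ! i) x)" by blast
    then show ?case by (intro bexI[of _ "\<lambda>c. P c + Q c"]) (auto intro: alg_add)
  next
    case (mult f g)
    then obtain P Q where "P \<in> alg (coords n)" "Q \<in> alg (coords n)"
      "\<forall>x. f x = P (\<lambda>i. (fs ! i) x)" "\<forall>x. g x = Q (\<lambda>i. (fs ! i) x)" by blast
    then show ?case by (intro bexI[of _ "\<lambda>c. P c * Q c"]) (auto intro: alg_mult)
  qed
  then show ?thesis using that by blast
qed


section \<open>Products of non-zero polynomial functions\<close>

text \<open>On a line, polynomial functions become polynomials in one variable. If \<open>f * g = 0\<close>, a line that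
  joins a point with \<open>f \<noteq> 0\<close> to a point with \<open>g \<noteq> 0\<close> therefore gives a contradiction.\<close>

lemma alg_restrict_line:
  assumes "f \<in> alg X" and "\<And>g. g \<in> X \<Longrightarrow> \<exists>p. \<forall>t. g (\<gamma> t) = poly p t"
  shows "\<exists>p. \<forall>t :: complex. f (\<gamma> t) = poly p t"
  using assms(1)
proof (induction rule: alg_induct)
  case (const c)
  show ?case by (rule exI[of _ "[:c:]"]) simp
next
  case (add f g)
  then show ?case by (metis poly_add)
next
  case (mult f g)
  then show ?case by (metis poly_mult)
qed (rule assms(2))

lemma alg_domain_line:
  fixes \<gamma> :: "complex \<Rightarrow> 'x"
  assumes "f \<in> alg X" "g \<in> alg X" and "\<And>x. f x * g x = 0"
    and "\<And>h. h \<in> X \<Longrightarrow> \<exists>p. \<forall>t. h (\<gamma> t) = poly p t"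
  shows "f (\<gamma> 0) = 0 \<or> g (\<gamma> 1) = 0"
proof -
  obtain p where p: "\<forall>t. f (\<gamma> t) = poly p t"
    using alg_restrict_line[OF assms(1), of \<gamma>] assms(4) by auto
  obtain q where q: "\<forall>t. g (\<gamma> t) = poly q t"
    using alg_restrict_line[OF assms(2), of \<gamma>] assms(4) by auto
  from p q have "poly (p * q) t = 0" for t
    using assms(3)[of "\<gamma> t"] by simp
  then have "p * q = 0" using poly_all_0_iff_0 by blast
  then show ?thesis using p q by auto
qed

lemma alg_coords_domain:
  assumes "P \<in> alg (coords n)" "Q \<in> alg (coords n)" "\<And>c. P c * Q c = 0" "P c \<noteq> 0"
  shows "Q d = 0"
proof -
  let ?l = "\<lambda>t i. c i + t * (d i - c i)"
  have "\<exists>p. \<forall>t. h (?l t) = poly p t" if "h \<in> coords n" for h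
  proof -
    obtain i where "h = (\<lambda>c. c i)" using \<open>h \<in> coords n\<close> unfolding coords_def by (elim imageE)
    then show ?thesis by (intro exI[of _ "[:c i, d i - c i:]"]) auto
  qed
  from alg_domain_line[OF assms(1-3), of ?l, OF this] assms(4) show ?thesis by auto
qed

text \<open>A polynomial in \<open>n\<close> variables that vanishes on a dense part of the image of a dominant
  polynomial map \<open>\<phi>\<close> is zero. Here \<open>D z \<noteq> 0\<close> and \<open>D' c \<noteq> 0\<close> describe the dense parts of the source
  and of the target.\<close>

lemma alg_coords_zero_of_dominant:
  assumes P: "P \<in> alg (coords n)"
    and \<phi>: "\<And>i. i < n \<Longrightarrow> (\<lambda>z. \<phi> z i) \<in> alg (coords n)"
    and D: "D \<in> alg (coords n)" "D z0 \<noteq> 0"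
    and zero: "\<And>z. D z \<noteq> 0 \<Longrightarrow> P (\<phi> z) = 0"
    and D': "D' \<in> alg (coords n)" "D' c0 \<noteq> 0"
    and surj: "\<And>c. D' c \<noteq> 0 \<Longrightarrow> \<exists>z. \<forall>i<n. \<phi> z i = c i"
  shows "P c = 0"
proof -
  have "(\<lambda>z. P (\<phi> z)) \<in> alg (coords n)"
    using P \<phi> by (rule alg_coords_comp)
  moreover have "D z * P (\<phi> z) = 0" for z using zero[of z] by auto
  ultimately have *: "P (\<phi> z) = 0" for z
    using alg_coords_domain[OF D(1) _ _ D(2)] by blast
  have "P c = 0" if c: "D' c \<noteq> 0" for c
  proof -
    obtain z where "\<forall>i<n. \<phi> z i = c i" using surj[OF c] by blast
    then have "P (\<phi> z) = P c" by (intro alg_coords_cong[OF P]) auto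
    then show ?thesis using * by simp
  qed
  then have "D' c * P c = 0" for c by auto
  then show ?thesis
    using alg_coords_domain[OF D'(1) P _ D'(2)] by blast
qed


section \<open>Evaluation of multivariate polynomials\<close>

lemma meval_superset:
  assumes "finite S" "Poly_Mapping.keys p \<subseteq> S"
  shows "meval v p = (\<Sum>m\<in>S. Poly_Mapping.lookup p m *
        (\<Prod>i\<in>Poly_Mapping.keys m. v i ^ Poly_Mapping.lookup m i))"
  unfolding meval_def using assms by (intro sum.mono_neutral_left) (auto simp: in_keys_iff)

lemma prod_keys_superset:
  fixes m :: "'v \<Rightarrow>\<^sub>0 nat" and v :: "'v \<Rightarrow> complex"
  assumes "finite S" "Poly_Mapping.keys m \<subseteq> S"
  shows "(\<Prod>i\<in>Poly_Mapping.keys m. v i ^ Poly_Mapping.lookup m i)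
    = (\<Prod>i\<in>S. v i ^ Poly_Mapping.lookup m i)"
  using assms by (intro prod.mono_neutral_left) (auto simp: in_keys_iff)

lemma meval_add: "meval v (p + q) = meval v p + meval v q"
proof -
  let ?S = "Poly_Mapping.keys p \<union> Poly_Mapping.keys q"
  have "Poly_Mapping.keys (p + q) \<subseteq> ?S" by (rule Poly_Mapping.keys_add)
  then show ?thesis
    by (simp add: meval_superset[of ?S] lookup_add distrib_right sum.distrib)
qed

lemma meval_zero [simp]: "meval v 0 = 0"
  by (simp add: meval_def)

lemma meval_sum: "meval v (\<Sum>s\<in>S. p s) = (\<Sum>s\<in>S. meval v (p s))"
  by (induction S rule: infinite_finite_induct) (simp_all add: meval_add)

lemma meval_single: "meval v (Poly_Mapping.single m c)
    = c * (\<Prod>i\<in>Poly_Mapping.keys m. v i ^ Poly_Mapping.lookup m i)"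
  by (simp add: meval_def)

lemma poly_mapping_sum_single:
  "(\<Sum>m\<in>Poly_Mapping.keys p. Poly_Mapping.single m (Poly_Mapping.lookup p m)) = p"
  by (rule poly_mapping_eqI) (auto simp: lookup_sum lookup_single when_def in_keys_iff)

lemma prod_keys_add:
  fixes m n :: "'v \<Rightarrow>\<^sub>0 nat" and v :: "'v \<Rightarrow> complex"
  shows "(\<Prod>i\<in>Poly_Mapping.keys (m + n). v i ^ Poly_Mapping.lookup (m + n) i)
    = (\<Prod>i\<in>Poly_Mapping.keys m. v i ^ Poly_Mapping.lookup m i)
    * (\<Prod>i\<in>Poly_Mapping.keys n. v i ^ Poly_Mapping.lookup n i)"
proof -
  let ?S = "Poly_Mapping.keys m \<union> Poly_Mapping.keys n"
  have "(\<Prod>i\<in>Poly_Mapping.keys (m + n). v i ^ Poly_Mapping.lookup (m + n) i)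
      = (\<Prod>i\<in>?S. v i ^ Poly_Mapping.lookup (m + n) i)"
    by (rule prod_keys_superset) (simp, rule Poly_Mapping.keys_add)
  also have "\<dots> = (\<Prod>i\<in>?S. v i ^ Poly_Mapping.lookup m i) * (\<Prod>i\<in>?S. v i ^ Poly_Mapping.lookup n i)"
    by (simp add: lookup_add power_add prod.distrib)
  finally show ?thesis
    by (simp add: prod_keys_superset[of ?S])
qed

lemma mpoly_mult_eq_sum:
  fixes p q :: "'v mpoly"
  shows "p * q = (\<Sum>m\<in>Poly_Mapping.keys p. \<Sum>n\<in>Poly_Mapping.keys q.
    Poly_Mapping.single (m + n) (Poly_Mapping.lookup p m * Poly_Mapping.lookup q n))"
proof -
  have "p * q = (\<Sum>m\<in>Poly_Mapping.keys p. Poly_Mapping.single m (Poly_Mapping.lookup p m))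
      * (\<Sum>n\<in>Poly_Mapping.keys q. Poly_Mapping.single n (Poly_Mapping.lookup q n))"
    by (simp add: poly_mapping_sum_single)
  then show ?thesis by (simp add: sum_product mult_single)
qed

lemma meval_mult: "meval v (p * q) = meval v p * meval v q"
proof -
  have "meval v (p * q) = (\<Sum>m\<in>Poly_Mapping.keys p. \<Sum>n\<in>Poly_Mapping.keys q.
      (Poly_Mapping.lookup p m * (\<Prod>i\<in>Poly_Mapping.keys m. v i ^ Poly_Mapping.lookup m i))
    * (Poly_Mapping.lookup q n * (\<Prod>i\<in>Poly_Mapping.keys n. v i ^ Poly_Mapping.lookup n i)))"
    unfolding mpoly_mult_eq_sum by (simp add: meval_sum meval_single prod_keys_add mult_ac)
  also have "\<dots> = meval v p * meval v q"
    by (simp add: meval_def sum_product)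
  finally show ?thesis .
qed

lemma mdegree_superset:
  assumes "finite S" "Poly_Mapping.keys m \<subseteq> S"
  shows "mdegree m = (\<Sum>i\<in>S. Poly_Mapping.lookup m i)"
  unfolding mdegree_def using assms by (intro sum.mono_neutral_left) (auto simp: in_keys_iff)

lemma mdegree_add: "mdegree (m + n) = mdegree m + mdegree n"
proof -
  let ?S = "Poly_Mapping.keys m \<union> Poly_Mapping.keys n"
  have "Poly_Mapping.keys (m + n) \<subseteq> ?S" by (rule Poly_Mapping.keys_add)
  then show ?thesis by (simp add: mdegree_superset[of ?S] lookup_add sum.distrib)
qed

lemma mhomogeneous_add: "mhomogeneous d p \<Longrightarrow> mhomogeneous d q \<Longrightarrow> mhomogeneous d (p + q)"
  using Poly_Mapping.keys_add[of p q] by (auto simp: mhomogeneous_def)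

lemma mhomogeneous_mult:
  "mhomogeneous d p \<Longrightarrow> mhomogeneous e q \<Longrightarrow> mhomogeneous (d + e) (p * q)"
  using keys_mult[of p q] by (auto simp: mhomogeneous_def mdegree_add)

text \<open>Uniqueness of expansions in base \<open>B\<close>.\<close>

lemma digits_unique:
  fixes a b :: "nat \<Rightarrow> nat"
  assumes "\<And>i. i < n \<Longrightarrow> a i < B" "\<And>i. i < n \<Longrightarrow> b i < B"
    and "(\<Sum>i<n. a i * B ^ i) = (\<Sum>i<n. b i * B ^ i)" and "i < n"
  shows "a i = b i"
  using assms
proof (induction n arbitrary: a b i)
  case (Suc n)
  have shift: "(\<Sum>i<Suc n. f i * B ^ i) = f 0 + B * (\<Sum>i<n. f (Suc i) * B ^ i)" for f :: "nat \<Rightarrow> nat"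
    unfolding sum.lessThan_Suc_shift by (simp add: sum_distrib_left mult_ac)
  have eq: "a 0 + B * (\<Sum>i<n. a (Suc i) * B ^ i) = b 0 + B * (\<Sum>i<n. b (Suc i) * B ^ i)"
    using Suc.prems(3) unfolding shift .
  have lt: "a 0 < B" "b 0 < B" using Suc.prems by auto
  have 0: "a 0 = b 0"
    using arg_cong[OF eq, of "\<lambda>x. x mod B"] lt by simp
  with eq lt have eq': "(\<Sum>i<n. a (Suc i) * B ^ i) = (\<Sum>i<n. b (Suc i) * B ^ i)" by simp
  show ?case
  proof (cases i)
    case (Suc j)
    then show ?thesis
      using Suc.IH[of "\<lambda>i. a (Suc i)" "\<lambda>i. b (Suc i)" j] eq' Suc.prems by simp
  qed (use 0 in simp)
qed simp

text \<open>Kronecker's substitution \<open>v i = t ^ B ^ i\<close>, with \<open>B\<close> larger than every exponent of \<open>p\<close>, sends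
  distinct monomials to distinct powers of \<open>t\<close>.\<close>

lemma meval_eq_zero_imp_zero:
  fixes p :: "nat mpoly"
  assumes vars: "mvars p \<subseteq> {..<n}" and zero: "\<And>v. meval v p = 0"
  shows "p = 0"
proof -
  let ?K = "Poly_Mapping.keys p"
  have fin: "finite (\<Union>m\<in>?K. Poly_Mapping.lookup m ` {..<n})" by auto
  define B where "B = Suc (Max (insert 0 (\<Union>m\<in>?K. Poly_Mapping.lookup m ` {..<n})))"
  have B: "Poly_Mapping.lookup m i < B" if "m \<in> ?K" "i < n" for m i
    unfolding B_def less_Suc_eq_le using fin that by (intro Max_ge) auto
  define \<phi> where "\<phi> m = (\<Sum>i<n. Poly_Mapping.lookup m i * B ^ i)" for m :: "nat \<Rightarrow>\<^sub>0 nat"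
  have keys: "Poly_Mapping.keys m \<subseteq> {..<n}" if "m \<in> ?K" for m
    using vars that by (auto simp: mvars_def)
  have inj: "m = m'" if "m \<in> ?K" "m' \<in> ?K" "\<phi> m = \<phi> m'" for m m'
  proof (rule poly_mapping_eqI)
    fix i
    show "Poly_Mapping.lookup m i = Poly_Mapping.lookup m' i"
    proof (cases "i < n")
      case True
      then show ?thesis
        using digits_unique[of n "Poly_Mapping.lookup m" B "Poly_Mapping.lookup m'" i] B that
        by (simp add: \<phi>_def)
    next
      case False
      then show ?thesis
        using keys[OF that(1)] keys[OF that(2)] by (metis in_keys_iff lessThan_iff subsetD)
    qed
  qed
  define q where "q = (\<Sum>m\<in>?K. monom (Poly_Mapping.lookup p m) (\<phi> m))"
  have "poly q t = 0" for t
  proof -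
    have "(\<Prod>i\<in>Poly_Mapping.keys m. (t ^ B ^ i) ^ Poly_Mapping.lookup m i) = t ^ \<phi> m"
      if "m \<in> ?K" for m
      using prod_keys_superset[OF _ keys[OF that], of "\<lambda>i. t ^ B ^ i"]
      by (simp add: \<phi>_def power_sum mult.commute flip: power_mult)
    then have "poly q t = meval (\<lambda>i. t ^ B ^ i) p"
      by (simp add: q_def meval_def poly_sum poly_monom)
    then show ?thesis using zero by simp
  qed
  then have q0: "q = 0" using poly_all_0_iff_0 by blast
  have "Poly_Mapping.lookup p m = 0" if "m \<in> ?K" for m
  proof -
    have "coeff q (\<phi> m) = (\<Sum>m'\<in>?K. if m' = m then Poly_Mapping.lookup p m' else 0)"
      unfolding q_def coeff_sum coeff_monom using inj that by (intro sum.cong) auto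
    then show ?thesis using that q0 by simp
  qed
  then have "?K = {}" by (metis all_not_in_conv in_keys_iff)
  then show ?thesis by simp
qed

section \<open>Polynomial functions on traceless matrices\<close>

text \<open>The coordinate functions \<open>x \<mapsto> x\<^sub>i\<^sub>j\<close> on traceless matrices.\<close>

definition entries :: "(traceless \<Rightarrow> complex) set" where
  "entries = {\<lambda>x. mat_of x $ i $ j | i j. True}"

lemma alg_entry: "(\<lambda>x. mat_of x $ i $ j) \<in> alg entries"
  by (rule alg_gen) (auto simp: entries_def)

lemma homogeneous_poly_function_imp_poly_function:
  "homogeneous_poly_function d f \<Longrightarrow> poly_function f"
  by (auto simp: homogeneous_poly_function_def poly_function_def)

lemma homogeneous_poly_function_entry: "homogeneous_poly_function 1 (\<lambda>x. mat_of x $ i $ j)"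
  unfolding homogeneous_poly_function_def
  by (rule exI[of _ "Poly_Mapping.single (Poly_Mapping.single (i, j) 1) 1"])
     (simp add: meval_single mhomogeneous_def mdegree_def)

lemma homogeneous_poly_function_add:
  "homogeneous_poly_function d f \<Longrightarrow> homogeneous_poly_function d g \<Longrightarrow>
    homogeneous_poly_function d (\<lambda>x. f x + g x)"
  unfolding homogeneous_poly_function_def by (metis meval_add mhomogeneous_add)

lemma homogeneous_poly_function_mult:
  "homogeneous_poly_function d f \<Longrightarrow> homogeneous_poly_function e g \<Longrightarrow>
    homogeneous_poly_function (d + e) (\<lambda>x. f x * g x)"
  unfolding homogeneous_poly_function_def by (metis meval_mult mhomogeneous_mult)

lemma homogeneous_poly_function_zero: "homogeneous_poly_function d (\<lambda>x. 0)"
  unfolding homogeneous_poly_function_def by (rule exI[of _ 0]) (simp add: mhomogeneous_def)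

lemma homogeneous_poly_function_sum:
  "(\<And>s. s \<in> S \<Longrightarrow> homogeneous_poly_function d (f s)) \<Longrightarrow>
    homogeneous_poly_function d (\<lambda>x. \<Sum>s\<in>S. f s x)"
  by (induction S rule: infinite_finite_induct)
     (auto intro: homogeneous_poly_function_zero homogeneous_poly_function_add)

lemma poly_function_iff: "poly_function f \<longleftrightarrow> f \<in> alg entries"
proof
  assume "poly_function f"
  then obtain p :: "(3 \<times> 3) mpoly" where p: "\<And>x. f x = meval (\<lambda>(i, j). mat_of x $ i $ j) p"
    unfolding poly_function_def by blast
  have "(\<lambda>x. (case ij of (i, j) \<Rightarrow> mat_of x $ i $ j) ^ k) \<in> alg entries" for ij :: "3 \<times> 3" and k
    by (cases ij) (simp add: alg_power alg_entry)
  then have "(\<lambda>x. meval (\<lambda>(i, j). mat_of x $ i $ j) p) \<in> alg entries"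
    unfolding meval_def by (intro alg_sum alg_mult alg_prod alg_const) simp_all
  then show "f \<in> alg entries" using p by presburger
next
  assume "f \<in> alg entries"
  then show "poly_function f"
  proof (induction rule: alg_induct)
    case (gen g)
    then obtain i j where "g = (\<lambda>x. mat_of x $ i $ j)" by (auto simp: entries_def)
    then show ?case
      using homogeneous_poly_function_entry homogeneous_poly_function_imp_poly_function by blast
  next
    case (const c)
    show ?case
      unfolding poly_function_def
      by (rule exI[of _ "Poly_Mapping.single 0 c"]) (simp add: meval_single)
  next
    case (add f g)
    then show ?case unfolding poly_function_def by (metis meval_add)
  next
    case (mult f g)
    then show ?case unfolding poly_function_def by (metis meval_mult)
  qed
qed

lemma alg_entries_domain:
  assumes f: "f \<in> alg entries" and g: "g \<in> alg entries" and "\<And>x. f x * g x = 0" and "f x \<noteq> 0"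
  shows "g y = 0"
proof -
  define l where "l t = Traceless (\<chi> i j. mat_of x $ i $ j + t * (mat_of y $ i $ j - mat_of x $ i $ j))"
    for t
  have "trace (\<chi> i j. mat_of x $ i $ j + t * (mat_of y $ i $ j - mat_of x $ i $ j)) = 0" for t
    using mat_of[of x] mat_of[of y]
    by (simp add: trace_def sum.distrib sum_subtractf flip: sum_distrib_left)
  then have l: "mat_of (l t) $ i $ j = mat_of x $ i $ j + t * (mat_of y $ i $ j - mat_of x $ i $ j)"
    for t i j by (simp add: l_def Traceless_inverse)
  have "mat_of (l 0) = mat_of x" "mat_of (l 1) = mat_of y"
    by (simp_all add: vec_eq_iff l)
  then have l01: "l 0 = x" "l 1 = y" by (simp_all add: mat_of_inject)
  have "\<exists>p. \<forall>t. h (l t) = poly p t" if h: "h \<in> entries" for h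
  proof -
    obtain i j where "h = (\<lambda>x. mat_of x $ i $ j)" using h unfolding entries_def by blast
    then show ?thesis
      by (intro exI[of _ "[:mat_of x $ i $ j, mat_of y $ i $ j - mat_of x $ i $ j:]"]) (auto simp: l)
  qed
  from alg_domain_line[OF f g assms(3), of l, OF this] show ?thesis
    using assms(4) l01 by auto
qed


section \<open>Invariants of the conjugation action\<close>

lemma SO3_transpose_mult: "a \<in> SO3 \<Longrightarrow> transpose a ** a = mat 1"
  by (simp add: SO3_def matrix_left_right_inverse)

lemma matrix_inv_SO3:
  assumes "a \<in> SO3"
  shows "matrix_inv a = transpose a"
proof -
  have a: "a ** transpose a = mat 1" using assms by (simp add: SO3_def)
  then have "invertible a" by (auto simp: invertible_right_inverse)
  then have "matrix_inv a ** a = mat 1"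
    unfolding invertible_def matrix_inv_def by (rule someI2_ex) blast
  then have "matrix_inv a ** (a ** transpose a) = transpose a"
    by (simp add: matrix_mul_assoc)
  then show ?thesis by (simp add: a)
qed

lemma mat_of_conj_SO3:
  "a \<in> SO3 \<Longrightarrow> mat_of (conj_by a x) = a ** mat_of x ** transpose a"
  by (simp add: mat_of_conj_by matrix_inv_SO3)

lemma SO3_conj_mult:
  assumes "a \<in> SO3"
  shows "(a ** x ** transpose a) ** (a ** y ** transpose a) = a ** (x ** y) ** transpose a"
proof -
  have "(a ** x ** transpose a) ** (a ** y ** transpose a)
      = a ** x ** (transpose a ** a) ** y ** transpose a"
    by (simp add: matrix_mul_assoc)
  then show ?thesis by (simp add: SO3_transpose_mult[OF assms] matrix_mul_assoc)
qed

lemma SO3_conj_trace: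
  assumes "a \<in> SO3"
  shows "trace (a ** x ** transpose a) = trace x"
  by (metis SO3_transpose_mult[OF assms] matrix_mul_assoc matrix_mul_lid trace_mul_sym)

lemma SO3_conj_transpose:
  fixes a x :: "complex^3^3"
  shows "transpose (a ** x ** transpose a) = a ** transpose x ** transpose a"
  by (simp add: matrix_transpose_mul matrix_mul_assoc)

lemmas E_defs = E1_def E2_def E3_def E4_def E5_def E6_def

lemma E_conj:
  assumes "a \<in> SO3"
  shows "E1 (conj_by a x) = E1 x" "E2 (conj_by a x) = E2 x" "E3 (conj_by a x) = E3 x"
    "E4 (conj_by a x) = E4 x" "E5 (conj_by a x) = E5 x" "E6 (conj_by a x) = E6 x"
  unfolding E_defs Let_def mat_of_conj_SO3[OF assms] SO3_conj_transpose
    SO3_conj_mult[OF assms] SO3_conj_trace[OF assms]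
  by (rule refl)+

text \<open>Every word of length \<open>d\<close> in \<open>x\<close> and its transpose has entries that are homogeneous of
  degree \<open>d\<close>.\<close>

definition homogeneous_matrix :: "nat \<Rightarrow> (traceless \<Rightarrow> complex^3^3) \<Rightarrow> bool" where
  "homogeneous_matrix d A \<longleftrightarrow> (\<forall>i j. homogeneous_poly_function d (\<lambda>x. A x $ i $ j))"

lemma homogeneous_matrix_mat_of: "homogeneous_matrix 1 mat_of"
  unfolding homogeneous_matrix_def using homogeneous_poly_function_entry by blast

lemma homogeneous_matrix_transpose:
  "homogeneous_matrix d A \<Longrightarrow> homogeneous_matrix d (\<lambda>x. transpose (A x))"
  by (simp add: homogeneous_matrix_def transpose_def)

lemma homogeneous_matrix_mult:
  "homogeneous_matrix d A \<Longrightarrow> homogeneous_matrix e B \<Longrightarrow> homogeneous_matrix (d + e) (\<lambda>x. A x ** B x)"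
  unfolding homogeneous_matrix_def matrix_matrix_mult_def
  by (auto intro!: homogeneous_poly_function_sum homogeneous_poly_function_mult)

lemma homogeneous_matrix_trace:
  "homogeneous_matrix d A \<Longrightarrow> homogeneous_poly_function d (\<lambda>x. trace (A x))"
  unfolding homogeneous_matrix_def trace_def by (auto intro!: homogeneous_poly_function_sum)

lemma E_homogeneous:
  "\<exists>d. homogeneous_poly_function d E1" "\<exists>d. homogeneous_poly_function d E2"
  "\<exists>d. homogeneous_poly_function d E3" "\<exists>d. homogeneous_poly_function d E4"
  "\<exists>d. homogeneous_poly_function d E5" "\<exists>d. homogeneous_poly_function d E6"
  unfolding E_defs Let_def
  by (rule exI homogeneous_matrix_trace homogeneous_matrix_mult homogeneous_matrix_transpose
      homogeneous_matrix_mat_of)+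

lemma S3_iff: "f \<in> S3 \<longleftrightarrow> f \<in> alg entries \<and> (\<forall>a\<in>SO3. \<forall>x. f (conj_by a x) = f x)"
  by (simp add: S3_def poly_function_iff)

lemma E_in_S3: "E1 \<in> S3" "E2 \<in> S3" "E3 \<in> S3" "E4 \<in> S3" "E5 \<in> S3" "E6 \<in> S3"
  using E_homogeneous E_conj homogeneous_poly_function_imp_poly_function
  unfolding S3_def by blast+

lemma alg_S3: "X \<subseteq> S3 \<Longrightarrow> alg X \<subseteq> S3"
proof
  fix f assume "f \<in> alg X" "X \<subseteq> S3"
  from this(1) show "f \<in> S3"
    by (induction rule: alg_induct) (use \<open>X \<subseteq> S3\<close> in \<open>auto simp: S3_iff intro: alg_intros\<close>)
qed

lemma S3_dagger_subset_S3: "S3_dagger \<subseteq> S3"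
  unfolding S3_dagger_def by (rule alg_S3) (simp add: E_in_S3)

lemma alg_S3_eq: "alg S3 = S3"
  using alg_S3[of S3] alg_gen by blast

lemmas S3_intros = alg_intros[where X = S3, unfolded alg_S3_eq]


section \<open>The slice of matrices whose skew part has axis \<open>e\<^sub>3\<close>\<close>

text \<open>The general traceless matrix whose skew part is \<open>v \<mapsto> (r e\<^sub>3) \<times> v\<close>. The symmetric part has lower
  right entry \<open>a\<close>, the vector \<open>(p, q)\<close> next to it, and upper left block with traceless part given by
  \<open>(m, n)\<close>.\<close>

definition slice_matrix :: "complex \<Rightarrow> complex \<Rightarrow> complex \<Rightarrow> complex \<Rightarrow> complex \<Rightarrow> complex \<Rightarrow> complex^3^3" where
  "slice_matrix r a p q m n = vector
    [vector [- a / 2 + m, n - r, p], vector [n + r, - a / 2 - m, q], vector [p, q, a]]"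

lemma trace_slice_matrix: "trace (slice_matrix r a p q m n) = 0"
  by (simp add: slice_matrix_def trace_def sum_3 vector_3)

lemma mat_of_Traceless_slice: "mat_of (Traceless (slice_matrix r a p q m n)) = slice_matrix r a p q m n"
  by (simp add: Traceless_inverse trace_slice_matrix)

lemma vector_3_nested:
  "(vector [vector [a, b, c], vector [d, e, f], vector [g, h, i]] :: complex^3^3) = A \<longleftrightarrow>
    A $ 1 $ 1 = a \<and> A $ 1 $ 2 = b \<and> A $ 1 $ 3 = c \<and> A $ 2 $ 1 = d \<and> A $ 2 $ 2 = e \<and> A $ 2 $ 3 = f \<and>
    A $ 3 $ 1 = g \<and> A $ 3 $ 2 = h \<and> A $ 3 $ 3 = i"
  by (auto simp: vec_eq_iff forall_3 vector_3)

lemma E2_minus_E1: "E2 x - E1 x = (mat_of x $ 1 $ 2 - mat_of x $ 2 $ 1)\<^sup>2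
    + (mat_of x $ 1 $ 3 - mat_of x $ 3 $ 1)\<^sup>2 + (mat_of x $ 2 $ 3 - mat_of x $ 3 $ 2)\<^sup>2"
  by (simp add: E1_def E2_def Let_def trace_def matrix_matrix_mult_def transpose_def sum_3
      power2_eq_square algebra_simps)

text \<open>The negative of the reflection in the hyperplane orthogonal to \<open>q\<close>.\<close>

lemma neg_reflection_in_SO3:
  fixes q :: "3 \<Rightarrow> complex"
  assumes k: "k * ((q 1)\<^sup>2 + (q 2)\<^sup>2 + (q 3)\<^sup>2) = 2"
  shows "(\<chi> i j. k * q i * q j - (if i = j then 1 else 0)) \<in> SO3" (is "?a \<in> SO3")
proof -
  have "(?a ** transpose ?a) $ i $ j = mat 1 $ i $ j" for i j
  proof -
    have "(?a ** transpose ?a) $ i $ j = (\<Sum>l\<in>UNIV. k * q i * q j * (k * (q l)\<^sup>2)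
        - (if i = l then k * q j * q l else 0) - (if j = l then k * q i * q l else 0)
        + (if i = l then if j = l then 1 else 0 else 0))"
      unfolding matrix_matrix_mult_def transpose_def
      by (simp, intro sum.cong refl) (auto simp: power2_eq_square algebra_simps)
    also have "\<dots> = k * q i * q j * (k * (\<Sum>l\<in>UNIV. (q l)\<^sup>2)) - k * q j * q i - k * q i * q j
        + (if j = i then 1 else 0)"
      by (simp add: sum.distrib sum_subtractf flip: sum_distrib_left)
    also have "k * (\<Sum>l\<in>UNIV. (q l)\<^sup>2) = 2" using k by (simp add: sum_3)
    finally show ?thesis by (simp add: mat_def)
  qed
  then have "?a ** transpose ?a = mat 1" by (simp add: vec_eq_iff)
  moreover have "det ?a = k * ((q 1)\<^sup>2 + (q 2)\<^sup>2 + (q 3)\<^sup>2) - 1"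
    by (simp add: det_3 power2_eq_square algebra_simps)
  ultimately show ?thesis using k by (simp add: SO3_def)
qed

text \<open>The skew part of \<open>x\<close> is the cross product with half of an axis vector \<open>u\<close>, and \<open>E2 x - E1 x\<close> is
  the value \<open>u \<bullet> u\<close> of the bilinear form. If this is \<open>r\<^sup>2 \<noteq> 0\<close>, a reflection maps \<open>u\<close> to \<open>r e\<^sub>3\<close>.\<close>

lemma conj_into_slice:
  assumes "E2 x \<noteq> E1 x"
  obtains b r a p q m n where "b \<in> SO3" "conj_by b x = Traceless (slice_matrix r a p q m n)"
proof -
  define u :: "3 \<Rightarrow> complex" where "u = (\<lambda>i. if i = 1 then mat_of x $ 3 $ 2 - mat_of x $ 2 $ 3
    else if i = 2 then mat_of x $ 1 $ 3 - mat_of x $ 3 $ 1 else mat_of x $ 2 $ 1 - mat_of x $ 1 $ 2)"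
  have u: "u 1 = mat_of x $ 3 $ 2 - mat_of x $ 2 $ 3" "u 2 = mat_of x $ 1 $ 3 - mat_of x $ 3 $ 1"
    "u 3 = mat_of x $ 2 $ 1 - mat_of x $ 1 $ 2"
    by (simp_all add: u_def)
  have h: "E2 x - E1 x = (u 1)\<^sup>2 + (u 2)\<^sup>2 + (u 3)\<^sup>2"
    by (simp add: E2_minus_E1 u power2_eq_square algebra_simps)
  \<comment> \<open>The sign of the square root is chosen so that \<open>u - r e\<^sub>3\<close> is not isotropic.\<close>
  obtain r where r: "r\<^sup>2 = E2 x - E1 x" "r \<noteq> u 3"
  proof (cases "csqrt (E2 x - E1 x) = u 3")
    case True
    moreover have "csqrt (E2 x - E1 x) \<noteq> 0" using assms by simp
    ultimately have "- csqrt (E2 x - E1 x) \<noteq> u 3" by auto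
    then show ?thesis using that[of "- csqrt (E2 x - E1 x)"] by simp
  next
    case False
    then show ?thesis using that[of "csqrt (E2 x - E1 x)"] by simp
  qed
  have r0: "r \<noteq> 0" using r(1) assms by auto
  define q where "q i = u i - (if i = 3 then r else 0)" for i
  define k where "k = 1 / (r * (r - u 3))"
  have q: "q 1 = u 1" "q 2 = u 2" "q 3 = u 3 - r" by (simp_all add: q_def)
  have "(q 1)\<^sup>2 + (q 2)\<^sup>2 + (q 3)\<^sup>2 = 2 * (r * (r - u 3))"
    using r(1) h by (simp add: q power2_eq_square algebra_simps)
  then have k: "k * ((q 1)\<^sup>2 + (q 2)\<^sup>2 + (q 3)\<^sup>2) = 2"
    using r(2) r0 by (simp add: k_def)
  define b :: "complex^3^3" where "b = (\<chi> i j. k * q i * q j - (if i = j then 1 else 0))"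
  have b: "b \<in> SO3" using neg_reflection_in_SO3[OF k] by (simp add: b_def)
  define y where "y = mat_of (conj_by b x)"
  have y: "y = b ** mat_of x ** transpose b" by (simp add: y_def mat_of_conj_SO3[OF b])
  \<comment> \<open>The third row of \<open>b\<close> is proportional to \<open>u\<close>, which spans the kernel of the skew part of \<open>x\<close>.\<close>
  have kq: "k * q 3 = - 1 / r" using r(2) r0 by (simp add: k_def q field_simps)
  have b3: "b $ 3 $ j = - u j / r" for j
    using exhaust_3[of j] kq r0 by (auto simp: b_def q) (simp_all add: field_simps)
  have "y $ i $ 3 - y $ 3 $ i = 0" for i
    by (simp add: y matrix_matrix_mult_def transpose_def sum_3 b3 u)
       (simp add: field_simps r0)
  then have y3: "y $ 3 $ 1 = y $ 1 $ 3" "y $ 3 $ 2 = y $ 2 $ 3" by simp_all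
  have "y $ 1 $ 1 + y $ 2 $ 2 + y $ 3 $ 3 = 0"
    using mat_of[of "conj_by b x"] by (simp add: y_def trace_def sum_3)
  then have y11: "y $ 1 $ 1 = - y $ 2 $ 2 - y $ 3 $ 3" by (simp add: algebra_simps eq_neg_iff_add_eq_0)
  have "y = slice_matrix ((y $ 2 $ 1 - y $ 1 $ 2) / 2) (y $ 3 $ 3) (y $ 1 $ 3) (y $ 2 $ 3)
      ((y $ 1 $ 1 - y $ 2 $ 2) / 2) ((y $ 1 $ 2 + y $ 2 $ 1) / 2)"
    unfolding slice_matrix_def
    by (rule sym, rule iffD2[OF vector_3_nested]) (simp add: y3 y11 field_simps)
  then have "conj_by b x = Traceless (slice_matrix ((y $ 2 $ 1 - y $ 1 $ 2) / 2) (y $ 3 $ 3)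
      (y $ 1 $ 3) (y $ 2 $ 3) ((y $ 1 $ 1 - y $ 2 $ 2) / 2) ((y $ 1 $ 2 + y $ 2 $ 1) / 2))"
    by (metis mat_of_inverse y_def)
  then show ?thesis using that b by blast
qed

lemma E_slice_matrix:
  fixes r a p q m n :: complex
  defines "x \<equiv> Traceless (slice_matrix r a p q m n)"
    and "N \<equiv> p\<^sup>2 + q\<^sup>2" and "K \<equiv> m\<^sup>2 + n\<^sup>2" and "w \<equiv> (p\<^sup>2 - q\<^sup>2) * m + 2 * p * q * n"
  shows "E1 x = 2 * K + 2 * N + 3/2 * a\<^sup>2 - 2 * r\<^sup>2"
    and "E2 x = 2 * K + 2 * N + 3/2 * a\<^sup>2 + 2 * r\<^sup>2"
    and "E3 x = 3 * w - 3 * a * K + 3/2 * a * N + 3/4 * a^3 + 3 * r\<^sup>2 * a"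
    and "E4 x = 3 * w - 3 * a * K + 3/2 * a * N + 3/4 * a^3 - r\<^sup>2 * a"
    and "E5 x = (E1 x)\<^sup>2 / 2 + 4 * r\<^sup>2 * (a\<^sup>2 + N)"
  unfolding E_defs Let_def x_def mat_of_Traceless_slice
  by (simp_all add: slice_matrix_def N_def K_def w_def trace_def matrix_matrix_mult_def transpose_def
      sum_3 vector_3 field_simps power2_eq_square power3_eq_cube)

lemma trace_word6: 
  fixes x :: "complex^3^3"
  defines "A \<equiv> x ** transpose x" and "B \<equiv> x ** x"
  shows "trace (x ** transpose x ** x ** x ** transpose x ** transpose x) = trace (A ** (B ** transpose B))"
  by (simp add: A_def B_def matrix_transpose_mul matrix_mul_assoc)

text \<open>The parameter \<open>a = 2 d\<close> keeps the entries of the matrix free of denominators.\<close>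

lemma E6_slice_matrix:
  fixes r d p q m n :: complex
  defines "x \<equiv> Traceless (slice_matrix r (2 * d) p q m n)"
  shows "E6 x = E2 x * E5 x / 2 + (E4 x)\<^sup>2 / 2 - (E3 x)\<^sup>2 / 6 - 8 * r^3 * (2 * p * q * m - (p\<^sup>2 - q\<^sup>2) * n)"
proof -
  let ?s = "slice_matrix r (2 * d) p q m n"
  have A: "?s ** transpose ?s = vector
    [vector [(m-d)\<^sup>2 + (n-r)\<^sup>2 + p\<^sup>2, (m-d)*(n+r) - (n-r)*(d+m) + p*q, (m-d)*p + (n-r)*q + 2*p*d],
     vector [(m-d)*(n+r) - (n-r)*(d+m) + p*q, (n+r)\<^sup>2+(d+m)\<^sup>2+q\<^sup>2, (n+r)*p - (d+m)*q + 2*q*d],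
     vector [(m-d)*p + (n-r)*q + 2*p*d, (n+r)*p - (d+m)*q + 2*q*d, p\<^sup>2+q\<^sup>2+4*d\<^sup>2]]"
    by (rule sym, rule iffD2[OF vector_3_nested])
      (simp add: slice_matrix_def matrix_matrix_mult_def transpose_def sum_3 vector_3 algebra_simps power2_eq_square)
  have B: "?s ** ?s = vector
    [vector [(m-d)\<^sup>2 + (n-r)*(n+r) + p\<^sup>2, (m-d)*(n-r) - (n-r)*(d+m) + p*q, (m-d)*p + (n-r)*q + 2*p*d],
     vector [(m-d)*(n+r) - (n+r)*(d+m) + p*q, (n+r)*(n-r)+(d+m)\<^sup>2+q\<^sup>2, (n+r)*p - (d+m)*q + 2*q*d],
     vector [(m-d)*p + (n+r)*q + 2*p*d, (n-r)*p - (d+m)*q + 2*q*d, p\<^sup>2+q\<^sup>2+4*d\<^sup>2]]"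
    by (rule sym, rule iffD2[OF vector_3_nested])
      (simp add: slice_matrix_def matrix_matrix_mult_def transpose_def sum_3 vector_3 algebra_simps power2_eq_square)
  show ?thesis
    unfolding x_def E_slice_matrix
    unfolding E6_def Let_def trace_word6 mat_of_Traceless_slice A B
    by (simp add: trace_def matrix_matrix_mult_def transpose_def sum_3 vector_3) algebra
qed

text \<open>The slice in the coordinates \<open>\<rho> = c 0\<close>, \<open>a = c 1\<close> and in the pairs \<open>c 2, c 3 = p \<plusminus> \<i> q\<close> and
  \<open>c 4, c 5 = m \<plusminus> \<i> n\<close>, which diagonalise the rotations about \<open>e\<^sub>3\<close>.\<close>

definition slice :: "(nat \<Rightarrow> complex) \<Rightarrow> traceless" where
  "slice c = Traceless (slice_matrix (c 0) (c 1) ((c 2 + c 3) / 2) (- \<i> * (c 2 - c 3) / 2)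
    ((c 4 + c 5) / 2) (- \<i> * (c 4 - c 5) / 2))"

lemma slice_matrix_eq_slice:
  obtains c where "Traceless (slice_matrix r a p q m n) = slice c"
proof
  show "Traceless (slice_matrix r a p q m n) = slice (\<lambda>i. if i = 0 then r else if i = 1 then a else
      if i = 2 then p + \<i> * q else if i = 3 then p - \<i> * q else if i = 4 then m + \<i> * n else m - \<i> * n)"
    by (simp add: slice_def mult.assoc[symmetric])
qed

text \<open>With \<open>X = (c 2)\<^sup>2 c 5\<close> and \<open>Y = (c 3)\<^sup>2 c 4\<close>, which are invariant under the rotations and exchanged by the
  half-turn about \<open>e\<^sub>1\<close>, these are \<open>(X + Y) / 2\<close> and \<open>X - Y\<close>.\<close>

definition slice_w :: "(nat \<Rightarrow> complex) \<Rightarrow> complex" where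
  "slice_w c = ((c 2)\<^sup>2 * c 5 + (c 3)\<^sup>2 * c 4) / 2"

definition slice_d :: "(nat \<Rightarrow> complex) \<Rightarrow> complex" where
  "slice_d c = (c 2)\<^sup>2 * c 5 - (c 3)\<^sup>2 * c 4"

lemma E_slice:
  shows "E1 (slice c) = 2 * (c 4 * c 5) + 2 * (c 2 * c 3) + 3/2 * (c 1)\<^sup>2 - 2 * (c 0)\<^sup>2"
    and "E2 (slice c) = 2 * (c 4 * c 5) + 2 * (c 2 * c 3) + 3/2 * (c 1)\<^sup>2 + 2 * (c 0)\<^sup>2"
    and "E3 (slice c) = 3 * slice_w c - 3 * c 1 * (c 4 * c 5) + 3/2 * c 1 * (c 2 * c 3)
      + 3/4 * (c 1)^3 + 3 * (c 0)\<^sup>2 * c 1"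
    and "E4 (slice c) = 3 * slice_w c - 3 * c 1 * (c 4 * c 5) + 3/2 * c 1 * (c 2 * c 3)
      + 3/4 * (c 1)^3 - (c 0)\<^sup>2 * c 1"
    and "E5 (slice c) = (E1 (slice c))\<^sup>2 / 2 + 4 * (c 0)\<^sup>2 * ((c 1)\<^sup>2 + c 2 * c 3)"
    and "E6 (slice c) = E2 (slice c) * E5 (slice c) / 2 + (E4 (slice c))\<^sup>2 / 2
      - (E3 (slice c))\<^sup>2 / 6 + 4 * \<i> * (c 0)^3 * slice_d c"
proof -
  have sq: "((x + y) / 2)\<^sup>2 + (- \<i> * (x - y) / 2)\<^sup>2 = x * y" for x y :: complex
    by (simp add: power2_eq_square field_simps)
  have w: "(((c 2 + c 3) / 2)\<^sup>2 - (- \<i> * (c 2 - c 3) / 2)\<^sup>2) * ((c 4 + c 5) / 2)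
      + 2 * ((c 2 + c 3) / 2) * (- \<i> * (c 2 - c 3) / 2) * (- \<i> * (c 4 - c 5) / 2) = slice_w c"
    by (simp add: slice_w_def power2_eq_square field_simps)
  have d: "2 * ((c 2 + c 3) / 2) * (- \<i> * (c 2 - c 3) / 2) * ((c 4 + c 5) / 2)
      - (((c 2 + c 3) / 2)\<^sup>2 - (- \<i> * (c 2 - c 3) / 2)\<^sup>2) * (- \<i> * (c 4 - c 5) / 2)
      = - \<i> * slice_d c / 2"
    by (simp add: slice_d_def power2_eq_square field_simps)
  show "E1 (slice c) = 2 * (c 4 * c 5) + 2 * (c 2 * c 3) + 3/2 * (c 1)\<^sup>2 - 2 * (c 0)\<^sup>2"
    and "E2 (slice c) = 2 * (c 4 * c 5) + 2 * (c 2 * c 3) + 3/2 * (c 1)\<^sup>2 + 2 * (c 0)\<^sup>2"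
    and "E3 (slice c) = 3 * slice_w c - 3 * c 1 * (c 4 * c 5) + 3/2 * c 1 * (c 2 * c 3)
      + 3/4 * (c 1)^3 + 3 * (c 0)\<^sup>2 * c 1"
    and "E4 (slice c) = 3 * slice_w c - 3 * c 1 * (c 4 * c 5) + 3/2 * c 1 * (c 2 * c 3)
      + 3/4 * (c 1)^3 - (c 0)\<^sup>2 * c 1"
    and "E5 (slice c) = (E1 (slice c))\<^sup>2 / 2 + 4 * (c 0)\<^sup>2 * ((c 1)\<^sup>2 + c 2 * c 3)"
    unfolding slice_def E_slice_matrix sq w by (rule refl)+
  show "E6 (slice c) = E2 (slice c) * E5 (slice c) / 2 + (E4 (slice c))\<^sup>2 / 2
      - (E3 (slice c))\<^sup>2 / 6 + 4 * \<i> * (c 0)^3 * slice_d c"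
    using E6_slice_matrix[of "c 0" "c 1 / 2" "(c 2 + c 3) / 2" "- \<i> * (c 2 - c 3) / 2"
        "(c 4 + c 5) / 2" "- \<i> * (c 4 - c 5) / 2"]
    unfolding d by (simp add: slice_def)
qed

lemma E2_minus_E1_slice: "(E2 (slice c) - E1 (slice c)) / 4 = (c 0)\<^sup>2"
  by (simp add: E_slice)

text \<open>Almost every orbit meets the slice, so an invariant is determined by its restriction to it.\<close>

lemma S3_eq_zero_if_zero_on_slice:
  assumes f: "f \<in> S3" and zero: "\<And>c. f (slice c) = 0"
  shows "f x = 0"
proof -
  have *: "f x = 0" if "E2 x \<noteq> E1 x" for x
  proof -
    obtain b r a p q m n where b: "b \<in> SO3" and "conj_by b x = Traceless (slice_matrix r a p q m n)"
      using conj_into_slice[OF \<open>E2 x \<noteq> E1 x\<close>] .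
    then obtain c where "conj_by b x = slice c" by (metis slice_matrix_eq_slice)
    then show ?thesis using f b zero[of c] by (metis S3_iff)
  qed
  have h: "(\<lambda>x. E2 x - E1 x) \<in> alg entries" using E_in_S3 by (simp add: S3_iff alg_diff)
  have "E2 (slice (\<lambda>_. 1)) - E1 (slice (\<lambda>_. 1)) \<noteq> 0" by (simp add: E_slice)
  moreover have "(E2 x - E1 x) * f x = 0" for x using *[of x] by auto
  ultimately show ?thesis
    using alg_entries_domain[OF h, of f "slice (\<lambda>_. 1)" x] f by (simp add: S3_iff)
qed

lemma alg_slice:
  assumes "f \<in> alg entries"
  shows "(\<lambda>c. f (slice c)) \<in> alg (coords 6)"
proof -
  have "(\<lambda>c. mat_of (slice c) $ i $ j) \<in> alg (coords 6)" for i j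
  proof -
    have "\<forall>i j. (\<lambda>c. mat_of (slice c) $ i $ j) \<in> alg (coords 6)"
      unfolding slice_def mat_of_Traceless_slice unfolding forall_3 slice_matrix_def vector_3
      by (intro conjI alg_intros alg_coord) simp_all
    then show ?thesis by blast
  qed
  then show ?thesis by (intro alg_comp[OF assms]) (auto simp: entries_def)
qed


section \<open>The stabiliser of the axis acting on the slice\<close>

text \<open>The actions, in slice coordinates, of the rotation by \<open>\<theta>\<close> about \<open>e\<^sub>3\<close> and of the half-turn about
  \<open>e\<^sub>1\<close>, which reverses the axis.\<close>

definition slice_rot :: "real \<Rightarrow> (nat \<Rightarrow> complex) \<Rightarrow> nat \<Rightarrow> complex" where
  "slice_rot \<theta> c = c(2 := cis \<theta> * c 2, 3 := cis (- \<theta>) * c 3, 4 := cis (2 * \<theta>) * c 4,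
     5 := cis (- 2 * \<theta>) * c 5)"

definition slice_flip :: "(nat \<Rightarrow> complex) \<Rightarrow> nat \<Rightarrow> complex" where
  "slice_flip c = c(0 := - c 0, 2 := - c 3, 3 := - c 2, 4 := c 5, 5 := c 4)"

lemma slice_matrix_cong:
  "r = r' \<Longrightarrow> a = a' \<Longrightarrow> p = p' \<Longrightarrow> q = q' \<Longrightarrow> m = m' \<Longrightarrow> n = n' \<Longrightarrow>
    slice_matrix r a p q m n = slice_matrix r' a' p' q' m' n'"
  by simp

lemma S3_slice_rot:
  assumes "f \<in> S3"
  shows "f (slice (slice_rot \<theta> c)) = f (slice c)"
proof -
  define C where "C = complex_of_real (cos \<theta>)"
  define S where "S = complex_of_real (sin \<theta>)"
  have CS: "C\<^sup>2 + S\<^sup>2 = 1"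
    unfolding C_def S_def by (metis of_real_1 of_real_add of_real_power sin_cos_squared_add2)
  have cis1: "cis \<theta> = C + \<i> * S" and cis1': "cis (- \<theta>) = C - \<i> * S"
    by (simp_all add: C_def S_def complex_eq_iff)
  have "cis (2 * \<theta>) = cis \<theta> * cis \<theta>" by (simp add: cis_mult)
  then have cis2: "cis (2 * \<theta>) = (C + \<i> * S)\<^sup>2" by (simp add: cis1 power2_eq_square)
  have "cis (- 2 * \<theta>) = cis (- \<theta>) * cis (- \<theta>)" by (simp add: cis_mult)
  then have cis2': "cis (- 2 * \<theta>) = (C - \<i> * S)\<^sup>2" by (simp add: cis1' power2_eq_square)
  define b :: "complex^3^3" where "b = vector [vector [C, - S, 0], vector [S, C, 0], vector [0, 0, 1]]"
  have b: "b \<in> SO3"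
    using CS by (simp add: SO3_def b_def det_3 vector_3 vec_eq_iff forall_3 mat_def
        matrix_matrix_mult_def transpose_def sum_3 power2_eq_square algebra_simps)
  have rot: "b ** slice_matrix r a p q m n ** transpose b = slice_matrix r a (C * p - S * q) (S * p + C * q)
      ((C\<^sup>2 - S\<^sup>2) * m - 2 * C * S * n) (2 * C * S * m + (C\<^sup>2 - S\<^sup>2) * n)" for r a p q m n
    unfolding slice_matrix_def b_def
    by (rule sym, rule iffD2[OF vector_3_nested], use CS in
        \<open>simp add: matrix_matrix_mult_def transpose_def sum_3 vector_3\<close>) (intro conjI; algebra)
  have "mat_of (conj_by b (slice c)) = mat_of (slice (slice_rot \<theta> c))"
    unfolding mat_of_conj_SO3[OF b] slice_def mat_of_Traceless_slice rot
    unfolding slice_rot_def cis1 cis1' cis2 cis2'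
    by (rule slice_matrix_cong) (simp_all add: power2_eq_square field_simps)
  then have "conj_by b (slice c) = slice (slice_rot \<theta> c)" by (simp add: mat_of_inject)
  then show ?thesis using assms b by (metis S3_iff)
qed

lemma S3_slice_flip:
  assumes "f \<in> S3"
  shows "f (slice (slice_flip c)) = f (slice c)"
proof -
  define b :: "complex^3^3" where "b = vector [vector [1, 0, 0], vector [0, - 1, 0], vector [0, 0, - 1]]"
  have b: "b \<in> SO3"
    by (simp add: SO3_def b_def det_3 vector_3 vec_eq_iff forall_3 mat_def
        matrix_matrix_mult_def transpose_def sum_3)
  have flip: "b ** slice_matrix r a p q m n ** transpose b = slice_matrix (- r) a (- p) q m (- n)"
    for r a p q m n
    unfolding slice_matrix_def b_def
    by (rule sym, rule iffD2[OF vector_3_nested])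
       (simp add: matrix_matrix_mult_def transpose_def sum_3 vector_3)
  have "mat_of (conj_by b (slice c)) = mat_of (slice (slice_flip c))"
    unfolding mat_of_conj_SO3[OF b] slice_def mat_of_Traceless_slice flip
    by (intro slice_matrix_cong) (simp_all add: slice_flip_def field_simps)
  then have "conj_by b (slice c) = slice (slice_flip c)" by (simp add: mat_of_inject)
  then show ?thesis using assms b by (metis S3_iff)
qed

text \<open>The rotation by \<open>\<theta>\<close> multiplies a monomial with exponents \<open>i, j, k, l\<close> in \<open>c 2, c 3, c 4, c 5\<close> by
  \<open>cis (w \<theta>)\<close> with the weight \<open>w = i - j + 2 k - 2 l\<close>. The following functions generate the algebra
  spanned by the monomials of weight zero.\<close>

definition weight_zero_gens :: "((nat \<Rightarrow> complex) \<Rightarrow> complex) set" where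
  "weight_zero_gens = {\<lambda>c. c 0, \<lambda>c. c 1, \<lambda>c. c 2 * c 3, \<lambda>c. c 4 * c 5,
     \<lambda>c. (c 2)\<^sup>2 * c 5, \<lambda>c. (c 3)\<^sup>2 * c 4}"

lemma weight_zero_monomial:
  assumes "i + 2 * k = j + 2 * l"
  shows "(\<lambda>c. c 2 ^ i * c 3 ^ j * c 4 ^ k * c 5 ^ l) \<in> alg weight_zero_gens"
  using assms
proof (induction "i + j + k + l" arbitrary: i j k l rule: less_induct)
  case less
  note gens = alg_gen[where X = weight_zero_gens]
  consider "i > 0 \<and> j > 0" | "k > 0 \<and> l > 0" | "j = 0" "k = 0" | "i = 0" "l = 0" 
    using less.prems by (cases "i = 0"; cases "j = 0"; cases "k = 0"; cases "l = 0") auto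
  then show ?case
  proof cases
    case 1
    then obtain i' j' where ij: "i = Suc i'" "j = Suc j'" by (metis gr0_implies_Suc)
    have "(\<lambda>c. (c 2 * c 3) * (c 2 ^ i' * c 3 ^ j' * c 4 ^ k * c 5 ^ l)) \<in> alg weight_zero_gens"
      using less ij by (intro alg_mult gens less.hyps) (auto simp: weight_zero_gens_def)
    then show ?thesis by (simp add: ij mult_ac)
  next
    case 2
    then obtain k' l' where kl: "k = Suc k'" "l = Suc l'" by (metis gr0_implies_Suc)
    have "(\<lambda>c. (c 4 * c 5) * (c 2 ^ i * c 3 ^ j * c 4 ^ k' * c 5 ^ l')) \<in> alg weight_zero_gens"
      using less kl by (intro alg_mult gens less.hyps) (auto simp: weight_zero_gens_def)
    then show ?thesis by (simp add: kl mult_ac)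
  next
    case 3
    then have "i = 2 * l" using less.prems by simp
    then have "(\<lambda>c :: nat \<Rightarrow> complex. c 2 ^ i * c 3 ^ j * c 4 ^ k * c 5 ^ l) = (\<lambda>c. ((c 2)\<^sup>2 * c 5) ^ l)"
      using 3 by (simp add: power_mult power_mult_distrib)
    moreover have "(\<lambda>c. ((c 2)\<^sup>2 * c 5) ^ l) \<in> alg weight_zero_gens"
      by (intro alg_power gens) (simp add: weight_zero_gens_def)
    ultimately show ?thesis by simp
  next
    case 4
    then have "j = 2 * k" using less.prems by simp
    then have "(\<lambda>c :: nat \<Rightarrow> complex. c 2 ^ i * c 3 ^ j * c 4 ^ k * c 5 ^ l) = (\<lambda>c. ((c 3)\<^sup>2 * c 4) ^ k)"
      using 4 by (simp add: power_mult power_mult_distrib)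
    moreover have "(\<lambda>c. ((c 3)\<^sup>2 * c 4) ^ k) \<in> alg weight_zero_gens"
      by (intro alg_power gens) (simp add: weight_zero_gens_def)
    ultimately show ?thesis by simp
  qed
qed

text \<open>Polynomials in six variables as sums of scaled monomials: the form in which the weights of the
  summands are visible.\<close>

inductive_set monomial_span :: "((nat \<Rightarrow> complex) \<Rightarrow> complex) set" where
  monomial: "(\<lambda>c. a * c 0 ^ s * c 1 ^ t * (c 2 ^ i * c 3 ^ j * c 4 ^ k * c 5 ^ l)) \<in> monomial_span"
| add: "f \<in> monomial_span \<Longrightarrow> g \<in> monomial_span \<Longrightarrow> (\<lambda>c. f c + g c) \<in> monomial_span"

lemma monomial_span_mult:
  assumes "f \<in> monomial_span" "g \<in> monomial_span"
  shows "(\<lambda>c. f c * g c) \<in> monomial_span"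
  using assms
proof (induction arbitrary: g rule: monomial_span.induct)
  case (monomial a s t i j k l)
  then show ?case
  proof (induction rule: monomial_span.induct)
    case (monomial a' s' t' i' j' k' l')
    show ?case
      using monomial_span.monomial[of "a * a'" "s + s'" "t + t'" "i + i'" "j + j'" "k + k'" "l + l'"]
      by (simp add: power_add mult_ac)
  next
    case (add f g)
    then show ?case using monomial_span.add[OF add.IH] by (simp add: distrib_left)
  qed
next
  case (add f1 f2)
  then show ?case using monomial_span.add[OF add.IH(1,2)[OF add.prems]] by (simp add: distrib_right)
qed

lemma alg_coords_6_monomial_span:
  assumes "f \<in> alg (coords 6)"
  shows "f \<in> monomial_span"
  using assms
proof (induction rule: alg_induct)
  case (gen g)
  then obtain i where i: "g = (\<lambda>c. c i)" "i < 6" unfolding coords_def by blast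
  then consider "i = 0" | "i = 1" | "i = 2" | "i = 3" | "i = 4" | "i = 5" by linarith
  then show ?case
    using monomial_span.monomial[of 1 1 0 0 0 0 0] monomial_span.monomial[of 1 0 1 0 0 0 0]
      monomial_span.monomial[of 1 0 0 1 0 0 0] monomial_span.monomial[of 1 0 0 0 1 0 0]
      monomial_span.monomial[of 1 0 0 0 0 1 0] monomial_span.monomial[of 1 0 0 0 0 0 1]
    by cases (simp_all add: i(1))
next
  case (const c)
  then show ?case using monomial_span.monomial[of c 0 0 0 0 0 0] by simp
qed (auto intro: monomial_span.add monomial_span_mult)

lemma sum_cis_roots:
  fixes j :: int
  assumes "\<bar>j\<bar> < int N" "j \<noteq> 0"
  shows "(\<Sum>k<N. cis (2 * pi * real k / real N * of_int j)) = 0"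
proof -
  define x where "x = 2 * pi * of_int j / real N"
  have N: "N > 0" using assms by auto
  have "cis x \<noteq> 1"
  proof
    assume "cis x = 1"
    then have "cos x = 1" by (simp add: complex_eq_iff)
    then obtain n :: int where "x = of_int n * 2 * pi" using cos_one_2pi_int by blast
    then have "of_int j = (of_int n * of_int (int N) :: real)" using N by (simp add: x_def field_simps)
    then have "j = n * int N" by (metis of_int_eq_iff of_int_mult)
    then have "int N dvd j" by simp
    then show False using assms zdvd_not_zless[of "\<bar>j\<bar>" "int N"] by auto
  qed
  moreover have "cis x ^ N = 1"
    using N cis_multiple_2pi[of "of_int j"] by (simp add: Complex.DeMoivre x_def)
  ultimately have "(\<Sum>k<N. cis x ^ k) = 0" by (simp add: geometric_sum)
  then show ?thesis by (simp add: Complex.DeMoivre x_def mult_ac)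
qed

text \<open>Averaging over sufficiently many roots of unity projects onto the part of weight zero.\<close>

lemma average_weight_zero:
  assumes "f \<in> monomial_span"
  shows "\<exists>N0. \<forall>N\<ge>N0. (\<lambda>c. (\<Sum>k<N. f (slice_rot (2 * pi * real k / real N) c)) / of_nat N)
    \<in> alg weight_zero_gens"
  using assms
proof induction
  case (monomial a s t i j k l)
  let ?f = "\<lambda>c. a * c 0 ^ s * c 1 ^ t * (c 2 ^ i * c 3 ^ j * c 4 ^ k * c 5 ^ l)"
  define w :: int where "w = int i - int j + 2 * int k - 2 * int l"
  have scale: "?f (slice_rot \<theta> c) = cis (\<theta> * of_int w) * ?f c" for \<theta> c
  proof -
    have "cis (\<theta> * of_int w) = cis \<theta> ^ i * cis (- \<theta>) ^ j * cis (2 * \<theta>) ^ k * cis (- 2 * \<theta>) ^ l"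
      unfolding Complex.DeMoivre cis_mult by (simp add: w_def algebra_simps)
    then show ?thesis by (simp add: slice_rot_def power_mult_distrib mult_ac)
  qed
  have avg: "(\<Sum>m<N. ?f (slice_rot (2 * pi * real m / real N) c)) / of_nat N
      = (\<Sum>m<N. cis (2 * pi * real m / real N * of_int w)) / of_nat N * ?f c" for N c
    unfolding scale by (simp flip: sum_distrib_right)
  show ?case
  proof (cases "w = 0")
    case True
    then have "i + 2 * k = j + 2 * l" by (simp add: w_def)
    then have "?f \<in> alg weight_zero_gens"
      by (intro alg_mult alg_const alg_power weight_zero_monomial)
         (auto intro!: alg_gen simp: weight_zero_gens_def)
    then show ?thesis
      unfolding avg True by (intro exI[of _ 1]) simp
  next
    case False
    have "(\<Sum>m<N. cis (2 * pi * real m / real N * of_int w)) = 0" if "N \<ge> Suc (nat \<bar>w\<bar>)" for N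
      using False that by (intro sum_cis_roots) auto
    then show ?thesis unfolding avg by (intro exI[of _ "Suc (nat \<bar>w\<bar>)"]) (simp add: alg_const)
  qed
next
  case (add f g)
  then obtain N1 N2 where
    N1: "\<And>N. N \<ge> N1 \<Longrightarrow> (\<lambda>c. (\<Sum>k<N. f (slice_rot (2 * pi * real k / real N) c)) / of_nat N) \<in> alg weight_zero_gens"
    and N2: "\<And>N. N \<ge> N2 \<Longrightarrow> (\<lambda>c. (\<Sum>k<N. g (slice_rot (2 * pi * real k / real N) c)) / of_nat N) \<in> alg weight_zero_gens"
    by blast
  show ?case
    using alg_add[OF N1 N2]
    by (intro exI[of _ "max N1 N2"]) (simp add: sum.distrib add_divide_distrib)
qed

lemma S3_slice_weight_zero:
  assumes "f \<in> S3"
  shows "(\<lambda>c. f (slice c)) \<in> alg weight_zero_gens"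
proof -
  have "(\<lambda>c. f (slice c)) \<in> monomial_span"
    using assms by (intro alg_coords_6_monomial_span alg_slice) (simp add: S3_iff)
  then obtain N0 where N0: "\<And>N. N \<ge> N0 \<Longrightarrow>
      (\<lambda>c. (\<Sum>k<N. f (slice (slice_rot (2 * pi * real k / real N) c))) / of_nat N) \<in> alg weight_zero_gens"
    using average_weight_zero by blast
  show ?thesis using N0[of "Suc N0"] by (simp add: S3_slice_rot[OF assms] del: of_nat_Suc)
qed

section \<open>Invariants up to a power of the norm of the axis\<close>

text \<open>Adjoining a square root \<open>\<theta>\<close> of an element of an algebra gives a module spanned by \<open>1\<close> and \<open>\<theta>\<close>.\<close>

lemma alg_insert_sqrt:
  assumes \<theta>: "(\<lambda>x. (\<theta> x)\<^sup>2) \<in> alg X" and f: "f \<in> alg (insert \<theta> X)"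
  shows "\<exists>A\<in>alg X. \<exists>B\<in>alg X. \<forall>x. f x = A x + \<theta> x * B x"
  using f
proof (induction rule: alg_induct)
  case (gen g)
  then show ?case
  proof
    assume "g = \<theta>"
    then show ?thesis
      by (intro bexI[of _ "\<lambda>_. 0"] bexI[of _ "\<lambda>_. 1"]) (simp_all add: alg_const)
  next
    assume "g \<in> X"
    then show ?thesis
      by (intro bexI[of _ g] bexI[of _ "\<lambda>_. 0"]) (simp_all add: alg_const alg_gen)
  qed
next
  case (const c)
  show ?case by (intro bexI[of _ "\<lambda>_. c"] bexI[of _ "\<lambda>_. 0"]) (simp_all add: alg_const)
next
  case (add f g)
  then obtain A B A' B' where AB: "A \<in> alg X" "B \<in> alg X" "A' \<in> alg X" "B' \<in> alg X"
    and eq: "\<forall>x. f x = A x + \<theta> x * B x" "\<forall>x. g x = A' x + \<theta> x * B' x" by blast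
  show ?case
    by (rule rev_bexI[OF alg_add[OF AB(1,3)]], rule rev_bexI[OF alg_add[OF AB(2,4)]])
       (simp add: eq algebra_simps)
next
  case (mult f g)
  then obtain A B A' B' where AB: "A \<in> alg X" "B \<in> alg X" "A' \<in> alg X" "B' \<in> alg X"
    and eq: "\<forall>x. f x = A x + \<theta> x * B x" "\<forall>x. g x = A' x + \<theta> x * B' x" by blast
  have 1: "(\<lambda>x. A x * A' x + (\<theta> x)\<^sup>2 * (B x * B' x)) \<in> alg X"
    and 2: "(\<lambda>x. A x * B' x + B x * A' x) \<in> alg X"
    by (intro alg_add alg_mult AB \<theta>)+
  show ?case
    by (rule rev_bexI[OF 1], rule rev_bexI[OF 2]) (simp add: eq algebra_simps power2_eq_square)
qed

text \<open>Over the algebra of these functions, which are invariant under rotations and half-turn, the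
  functions of weight zero are generated by the two square roots \<open>c 0\<close> and \<^const>\<open>slice_d\<close>.\<close>

definition slice_gens :: "((nat \<Rightarrow> complex) \<Rightarrow> complex) set" where
  "slice_gens = {\<lambda>c. (c 0)\<^sup>2, \<lambda>c. c 1, \<lambda>c. c 2 * c 3, \<lambda>c. c 4 * c 5, slice_w}"

lemma slice_gens_mem:
  "(\<lambda>c. (c 0)\<^sup>2) \<in> alg slice_gens" "(\<lambda>c. c 1) \<in> alg slice_gens"
  "(\<lambda>c. c 2 * c 3) \<in> alg slice_gens" "(\<lambda>c. c 4 * c 5) \<in> alg slice_gens" "slice_w \<in> alg slice_gens"
  by (rule alg_gen, simp add: slice_gens_def)+

lemma weight_zero_split:
  assumes "f \<in> alg weight_zero_gens"
  obtains A1 A2 A3 A4 where "A1 \<in> alg slice_gens" "A2 \<in> alg slice_gens" "A3 \<in> alg slice_gens"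
    "A4 \<in> alg slice_gens"
    "\<And>c. f c = A1 c + slice_d c * A2 c + c 0 * (A3 c + slice_d c * A4 c)"
proof -
  let ?X = "insert slice_d slice_gens"
  let ?Y = "insert (\<lambda>c. c 0) ?X"
  have "slice_gens \<subseteq> ?Y" by blast
  then have sub: "A \<in> alg slice_gens \<Longrightarrow> A \<in> alg ?Y" for A
    using alg_subset[of slice_gens ?Y] alg_gen by blast
  have "weight_zero_gens \<subseteq> alg ?Y"
  proof -
    have d: "slice_d \<in> alg ?Y" and c0: "(\<lambda>c. c 0) \<in> alg ?Y" by (simp_all add: alg_gen)
    have "(\<lambda>c. (c 2)\<^sup>2 * c 5) = (\<lambda>c. slice_w c + slice_d c / 2)"
      "(\<lambda>c. (c 3)\<^sup>2 * c 4) = (\<lambda>c. slice_w c - slice_d c / 2)"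
      by (simp_all add: slice_w_def slice_d_def field_simps)
    then have "(\<lambda>c. (c 2)\<^sup>2 * c 5) \<in> alg ?Y" "(\<lambda>c. (c 3)\<^sup>2 * c 4) \<in> alg ?Y"
      using d sub[OF slice_gens_mem(5)] by (simp_all add: alg_add alg_diff alg_divide_const)
    then show ?thesis
      using c0 slice_gens_mem(2-4)[THEN sub] by (simp add: weight_zero_gens_def)
  qed
  then have f: "f \<in> alg ?Y" using assms alg_subset by blast
  have "(\<lambda>c. (c 0)\<^sup>2) \<in> alg ?X" by (rule alg_gen) (simp add: slice_gens_def)
  from alg_insert_sqrt[OF this f] obtain P Q where PQ: "P \<in> alg ?X" "Q \<in> alg ?X"
    and f_eq: "\<And>c. f c = P c + c 0 * Q c" by auto
  have "(slice_d c)\<^sup>2 = 4 * (slice_w c)\<^sup>2 - 4 * (c 2 * c 3)\<^sup>2 * (c 4 * c 5)" for c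
    unfolding slice_d_def slice_w_def power_divide by simp algebra
  then have d2: "(\<lambda>c. (slice_d c)\<^sup>2) \<in> alg slice_gens"
    using slice_gens_mem by (simp add: alg_intros)
  from alg_insert_sqrt[OF d2 PQ(1)] alg_insert_sqrt[OF d2 PQ(2)] f_eq that show ?thesis
    by (metis (no_types, lifting))
qed

text \<open>The half-turn fixes \<^const>\<open>slice_gens\<close> and changes the sign of \<open>c 0\<close> and of \<^const>\<open>slice_d\<close>, so only
  their product survives.\<close>

lemma S3_slice_form:
  assumes "f \<in> S3"
  obtains A B where "A \<in> alg slice_gens" "B \<in> alg slice_gens"
    "\<And>c. f (slice c) = A c + c 0 * slice_d c * B c"
proof -
  obtain A1 A2 A3 A4 where A: "A1 \<in> alg slice_gens" "A2 \<in> alg slice_gens" "A3 \<in> alg slice_gens"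
      "A4 \<in> alg slice_gens"
    and f: "\<And>c. f (slice c) = A1 c + slice_d c * A2 c + c 0 * (A3 c + slice_d c * A4 c)"
    by (rule weight_zero_split[OF S3_slice_weight_zero[OF assms]], rule that)
  have inv: "G (slice_flip c) = G c" if "G \<in> alg slice_gens" for G c
    using that
    by (induction rule: alg_induct) (auto simp: slice_gens_def slice_flip_def slice_w_def mult.commute add.commute)
  have flip: "slice_d (slice_flip c) = - slice_d c" "slice_flip c 0 = - c 0" for c
    by (simp_all add: slice_flip_def slice_d_def)
  have "f (slice c) = A1 c + c 0 * slice_d c * A4 c" for c
  proof -
    have "f (slice c) = A1 c - slice_d c * A2 c - c 0 * (A3 c - slice_d c * A4 c)"
      using S3_slice_flip[OF assms, of c] f[of "slice_flip c"] A by (simp add: inv flip)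
    then have "2 * f (slice c) = 2 * (A1 c + c 0 * slice_d c * A4 c)"
      using f[of c] by (simp add: algebra_simps)
    then show ?thesis by (rule mult_left_cancel[THEN iffD1, rotated]) simp
  qed
  then show ?thesis using that A by blast
qed

lemma dagger_E: "E1 \<in> S3_dagger" "E2 \<in> S3_dagger" "E3 \<in> S3_dagger" "E4 \<in> S3_dagger" "E5 \<in> S3_dagger"
  unfolding S3_dagger_def by (simp_all add: alg_gen)

lemmas dagger_intros = alg_intros[where X = "{E1, E2, E3, E4, E5}", folded S3_dagger_def]

text \<open>The value \<open>u \<bullet> u\<close> of the bilinear form on the axis \<open>u\<close> of the skew part \<open>v \<mapsto> u \<times> v\<close> of \<open>x\<close>.\<close>

definition axis_norm :: "traceless \<Rightarrow> complex" where
  "axis_norm x = (E2 x - E1 x) / 4"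

lemma axis_norm_dagger: "axis_norm \<in> S3_dagger"
  unfolding axis_norm_def by (intro dagger_intros dagger_E)

lemma axis_norm_slice: "axis_norm (slice c) = (c 0)\<^sup>2"
  by (simp add: axis_norm_def E2_minus_E1_slice)

text \<open>The functions in \<^const>\<open>slice_gens\<close> are restrictions of rational functions of \<open>E1, \<dots>, E5\<close>
  whose denominators are powers of \<^const>\<open>axis_norm\<close>.\<close>

lemma slice_gens_clear_denominator:
  assumes "A \<in> alg slice_gens"
  shows "\<exists>j. \<exists>G\<in>S3_dagger. \<forall>c. axis_norm (slice c) ^ j * A c = G (slice c)"
proof -
  let ?T = "\<lambda>A. \<exists>j. \<exists>G\<in>S3_dagger. \<forall>c. axis_norm (slice c) ^ j * A c = G (slice c)"
  have dagger: "?T (\<lambda>c. G (slice c))" if "G \<in> S3_dagger" for G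
    using that by (intro exI[of _ 0]) auto
  have add: "?T (\<lambda>c. A c + B c)" if AB: "?T A" "?T B" for A B
  proof -
    obtain i F where F: "F \<in> S3_dagger" "\<And>c. axis_norm (slice c) ^ i * A c = F (slice c)"
      using AB(1) by blast
    obtain j G where G: "G \<in> S3_dagger" "\<And>c. axis_norm (slice c) ^ j * B c = G (slice c)"
      using AB(2) by blast
    show ?thesis
    proof (intro exI[of _ "i + j"] bexI[of _ "\<lambda>x. axis_norm x ^ j * F x + axis_norm x ^ i * G x"] allI)
      show "(\<lambda>x. axis_norm x ^ j * F x + axis_norm x ^ i * G x) \<in> S3_dagger"
        by (intro dagger_intros axis_norm_dagger F(1) G(1))
    qed (simp add: power_add algebra_simps flip: F(2) G(2))
  qed
  have mult: "?T (\<lambda>c. A c * B c)" if AB: "?T A" "?T B" for A B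
  proof -
    obtain i F where F: "F \<in> S3_dagger" "\<And>c. axis_norm (slice c) ^ i * A c = F (slice c)"
      using AB(1) by blast
    obtain j G where G: "G \<in> S3_dagger" "\<And>c. axis_norm (slice c) ^ j * B c = G (slice c)"
      using AB(2) by blast
    show ?thesis
    proof (intro exI[of _ "i + j"] bexI[of _ "\<lambda>x. F x * G x"] allI)
      show "(\<lambda>x. F x * G x) \<in> S3_dagger" by (intro dagger_intros F(1) G(1))
    qed (simp add: power_add algebra_simps flip: F(2) G(2))
  qed
  have const: "?T (\<lambda>_. z)" for z
    by (rule dagger) (rule dagger_intros)
  have div: "?T A" if "G \<in> S3_dagger" "\<And>c. axis_norm (slice c) * A c = G (slice c)" for A G
    using that by (intro exI[of _ 1]) auto
  have a: "?T (\<lambda>c. c 1)"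
    by (rule div[of "\<lambda>x. (E3 x - E4 x) / 4"])
       (intro dagger_intros dagger_E, simp add: axis_norm_slice E_slice)
  have "?T (\<lambda>c. (c 1)\<^sup>2 + c 2 * c 3)"
    by (rule div[of "\<lambda>x. (E5 x - (E1 x)\<^sup>2 / 2) / 4"])
       (intro dagger_intros dagger_E, simp add: axis_norm_slice E_slice(5))
  from add[OF this mult[OF const[of "- 1"] mult[OF a a]]]
  have n: "?T (\<lambda>c. c 2 * c 3)" by (simp add: power2_eq_square)
  have "?T (\<lambda>c. (E1 (slice c) + E2 (slice c)) / 4)"
    by (rule dagger) (intro dagger_intros dagger_E)
  from add[OF this mult[OF const[of "- 1"] add[OF n mult[OF const[of "3/4"] mult[OF a a]]]]]
  have k: "?T (\<lambda>c. c 4 * c 5)" by (simp add: E_slice power2_eq_square field_simps)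
  have "?T (\<lambda>c. (E3 (slice c) + 3 * E4 (slice c)) / 12)"
    by (rule dagger) (intro dagger_intros dagger_E)
  from add[OF this mult[OF a add[OF k mult[OF const[of "- 1/2"] add[OF n mult[OF const[of "1/2"] mult[OF a a]]]]]]]
  have w: "?T slice_w" by (simp add: E_slice power2_eq_square power3_eq_cube field_simps)
  have h: "?T (\<lambda>c. (c 0)\<^sup>2)"
    using dagger[OF axis_norm_dagger] by (simp add: axis_norm_slice)
  show ?thesis
    using assms
  proof (induction rule: alg_induct)
    case (gen g)
    then show ?case using h a n k w unfolding slice_gens_def by auto
  qed (use const add mult in blast)+
qed

text \<open>On the slice, \<open>4 \<i> \<rho>\<^sup>3\<close> times \<^const>\<open>slice_d\<close> is the difference of \<open>E6\<close> and an element of the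
  algebra generated by the other invariants.\<close>

lemma S3_axis_norm_power_decomp:
  assumes "f \<in> S3"
  obtains j A B where "A \<in> S3_dagger" "B \<in> S3_dagger"
    "\<And>x. axis_norm x ^ j * f x = A x + B x * E6 x"
proof -
  obtain A B where AB: "A \<in> alg slice_gens" "B \<in> alg slice_gens"
    and f: "\<And>c. f (slice c) = A c + c 0 * slice_d c * B c"
    by (rule S3_slice_form[OF assms], rule that)
  obtain i F where F: "F \<in> S3_dagger" "\<And>c. axis_norm (slice c) ^ i * A c = F (slice c)"
    using slice_gens_clear_denominator[OF AB(1)] by blast
  obtain j G where G: "G \<in> S3_dagger" "\<And>c. axis_norm (slice c) ^ j * B c = G (slice c)"
    using slice_gens_clear_denominator[OF AB(2)] by blast
  define e where "e x = E2 x * E5 x / 2 + (E4 x)\<^sup>2 / 2 - (E3 x)\<^sup>2 / 6" for x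
  have e: "e \<in> S3_dagger" unfolding e_def by (intro dagger_intros dagger_E)
  have d: "axis_norm (slice c) * (c 0 * slice_d c) = (E6 (slice c) - e (slice c)) / (4 * \<i>)" for c
    unfolding E_slice(6) axis_norm_slice e_def by (simp add: power2_eq_square power3_eq_cube)
  define P where "P x = axis_norm x ^ (j + 1) * F x - axis_norm x ^ i * G x * e x / (4 * \<i>)" for x
  define Q where "Q x = axis_norm x ^ i * G x / (4 * \<i>)" for x
  have P: "P \<in> S3_dagger" and Q: "Q \<in> S3_dagger"
    unfolding P_def Q_def by (intro dagger_intros axis_norm_dagger F(1) G(1) e)+
  have "axis_norm (slice c) ^ (i + j + 1) * f (slice c) = P (slice c) + Q (slice c) * E6 (slice c)" for c
  proof -
    have "axis_norm (slice c) ^ (i + j + 1) * f (slice c)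
        = axis_norm (slice c) ^ (j + 1) * (axis_norm (slice c) ^ i * A c)
          + axis_norm (slice c) ^ i * (axis_norm (slice c) ^ j * B c) * (axis_norm (slice c) * (c 0 * slice_d c))"
      unfolding f by (simp add: power_add algebra_simps)
    also have "\<dots> = P (slice c) + Q (slice c) * E6 (slice c)"
      unfolding F(2) G(2) d P_def Q_def by (simp add: algebra_simps diff_divide_distrib)
    finally show ?thesis .
  qed
  moreover have "(\<lambda>x. axis_norm x ^ (i + j + 1) * f x - (P x + Q x * E6 x)) \<in> S3"
    using P Q axis_norm_dagger assms S3_dagger_subset_S3
    by (intro S3_intros) (auto intro: E_in_S3)
  ultimately have "axis_norm x ^ (i + j + 1) * f x - (P x + Q x * E6 x) = 0" for x
    using S3_eq_zero_if_zero_on_slice by force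
  then show ?thesis using that[OF P Q, of "i + j + 1"] by auto
qed


section \<open>Matrices with isotropic axis\<close>

text \<open>Matrices whose skew part has the isotropic axis \<open>(1, J, 0)\<close>, where \<open>J\<^sup>2 = -1\<close>. Changing the sign of
  \<open>b\<close> changes \<open>E6\<close>, if \<open>b e \<noteq> 0\<close>, but not \<open>E1, \<dots>, E5\<close>.\<close>

definition isotropic_matrix :: "complex \<Rightarrow> complex \<Rightarrow> complex \<Rightarrow> complex \<Rightarrow> complex \<Rightarrow> complex^3^3" where
  "isotropic_matrix J a b g e = vector
    [vector [a + e + g, J * (g - e), b + J], vector [J * (g - e), a - e - g, J * (b + J)],
     vector [b - J, J * (b - J), - 2 * a]]"

lemma trace_isotropic_matrix:
  fixes a b g e J :: complex
  assumes J: "J * J = - 1"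
  defines "X \<equiv> isotropic_matrix J a"
  shows "trace (X b g e) = 0"
    and "trace (X b g e ** X b g e) = 6 * a\<^sup>2 + 8 * e * g"
    and "trace (X b g e ** transpose (X b g e)) = 6 * a\<^sup>2 + 8 * e * g"
    and "trace (X b g e ** X b g e ** X b g e) = 12 * b\<^sup>2 * e + 24 * a * e * g - 6 * a^3 + 12 * e"
    and "trace (X b g e ** X b g e ** transpose (X b g e))
      = 12 * b\<^sup>2 * e + 24 * a * e * g - 6 * a^3 - 4 * e"
    and "trace (X b g e ** X b g e ** transpose (X b g e) ** transpose (X b g e))
      = (6 * a\<^sup>2 + 8 * e * g)\<^sup>2 / 2 + 32 * a * e"
  unfolding X_def isotropic_matrix_def using J
  by (simp_all add: trace_def matrix_matrix_mult_def transpose_def sum_3 vector_3) algebra+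

lemma trace_isotropic_matrix_word6:
  fixes a b g e J :: complex
  assumes J: "J * J = - 1"
  defines "T \<equiv> \<lambda>x :: complex^3^3. trace (x ** transpose x ** x ** x ** transpose x ** transpose x)"
  shows "T (isotropic_matrix J a (- b) g e) - T (isotropic_matrix J a b g e) = 256 * J * b * e\<^sup>2"
  unfolding isotropic_matrix_def T_def trace_word6 using J
  by (simp add: trace_def matrix_matrix_mult_def transpose_def sum_3 vector_3) algebra

definition isotropic :: "complex \<Rightarrow> complex \<Rightarrow> complex \<Rightarrow> complex \<Rightarrow> traceless" where
  "isotropic a b g e = Traceless (isotropic_matrix \<i> a b g e)"

lemma E_isotropic:
  fixes a b g e :: complex
  defines "x \<equiv> isotropic a b g e"
  shows "E1 x = 6 * a\<^sup>2 + 8 * e * g" and "E2 x = 6 * a\<^sup>2 + 8 * e * g"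
    and "E3 x = 12 * b\<^sup>2 * e + 24 * a * e * g - 6 * a^3 + 12 * e"
    and "E4 x = 12 * b\<^sup>2 * e + 24 * a * e * g - 6 * a^3 - 4 * e"
    and "E5 x = (6 * a\<^sup>2 + 8 * e * g)\<^sup>2 / 2 + 32 * a * e"
    and "E6 (isotropic a (- b) g e) - E6 x = 256 * \<i> * b * e\<^sup>2"
proof -
  have J: "\<i> * \<i> = - 1" by simp
  have m: "mat_of (isotropic a b g e) = isotropic_matrix \<i> a b g e" for b
    unfolding isotropic_def by (rule Traceless_inverse) (simp add: trace_isotropic_matrix(1)[OF J])
  show "E1 x = 6 * a\<^sup>2 + 8 * e * g" "E2 x = 6 * a\<^sup>2 + 8 * e * g"
    "E3 x = 12 * b\<^sup>2 * e + 24 * a * e * g - 6 * a^3 + 12 * e"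
    "E4 x = 12 * b\<^sup>2 * e + 24 * a * e * g - 6 * a^3 - 4 * e"
    "E5 x = (6 * a\<^sup>2 + 8 * e * g)\<^sup>2 / 2 + 32 * a * e"
    unfolding E_defs Let_def x_def m by (rule trace_isotropic_matrix[OF J])+
  show "E6 (isotropic a (- b) g e) - E6 x = 256 * \<i> * b * e\<^sup>2"
    unfolding E6_def Let_def x_def m by (rule trace_isotropic_matrix_word6[OF J])
qed

text \<open>The invariants \<open>E1, E3, E4, E5\<close> remain algebraically independent on the isotropic matrices, even
  with the points where \<open>E6\<close> does not change with the sign of \<open>b\<close> removed. Those invariants are
  polynomials in \<open>(a, b\<^sup>2, g, e)\<close>, and for \<open>E3 \<noteq> E4\<close> these four numbers can be solved for in turn.\<close>

lemma isotropic_dominant: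
  assumes P: "P \<in> alg (coords 4)"
    and zero: "\<And>a b g e. b \<noteq> 0 \<Longrightarrow> e \<noteq> 0 \<Longrightarrow> P (\<lambda>i. ([E1, E3, E4, E5] ! i) (isotropic a b g e)) = 0"
  shows "P c = 0"
proof -
  define \<phi> :: "(nat \<Rightarrow> complex) \<Rightarrow> nat \<Rightarrow> complex" where
    "\<phi> z i = [6 * (z 0)\<^sup>2 + 8 * z 3 * z 2, 12 * z 1 * z 3 + 24 * z 0 * z 3 * z 2 - 6 * z 0 ^ 3 + 12 * z 3,
      12 * z 1 * z 3 + 24 * z 0 * z 3 * z 2 - 6 * z 0 ^ 3 - 4 * z 3,
      (6 * (z 0)\<^sup>2 + 8 * z 3 * z 2)\<^sup>2 / 2 + 32 * z 0 * z 3] ! i" for z i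
  have less_4: "i < 4 \<longleftrightarrow> i = 0 \<or> i = 1 \<or> i = 2 \<or> i = 3" for i :: nat by auto
  show ?thesis
  proof (rule alg_coords_zero_of_dominant[OF P, of \<phi> "\<lambda>z. z 1 * z 3" "\<lambda>_. 1" "\<lambda>c. c 1 - c 2"
      "\<lambda>i. if i = 1 then 1 else 0"])
    fix i :: nat assume "i < 4"
    then show "(\<lambda>z. \<phi> z i) \<in> alg (coords 4)"
      unfolding less_4 \<phi>_def
      by (elim disjE) (simp_all add: alg_intros alg_coord)
  next
    fix z :: "nat \<Rightarrow> complex" assume z: "z 1 * z 3 \<noteq> 0"
    have "P (\<phi> z) = P (\<lambda>i. ([E1, E3, E4, E5] ! i) (isotropic (z 0) (csqrt (z 1)) (z 2) (z 3)))"
      by (rule alg_coords_cong[OF P]) (unfold less_4 \<phi>_def, elim disjE, simp_all add: E_isotropic)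
    then show "P (\<phi> z) = 0" using z zero by simp
  next
    fix c :: "nat \<Rightarrow> complex" assume c: "c 1 - c 2 \<noteq> 0"
    define e where "e = (c 1 - c 2) / 16"
    define a where "a = (c 3 - (c 0)\<^sup>2 / 2) / (32 * e)"
    define g where "g = (c 0 - 6 * a\<^sup>2) / (8 * e)"
    define b where "b = (c 1 - 12 * e - 24 * a * e * g + 6 * a ^ 3) / (12 * e)"
    have e: "e \<noteq> 0" using c by (simp add: e_def)
    have "c 2 = c 1 - 16 * e" by (simp add: e_def field_simps)
    moreover have "c 3 = (c 0)\<^sup>2 / 2 + 32 * a * e" using e by (simp add: a_def field_simps)
    moreover have "c 0 = 6 * a\<^sup>2 + 8 * e * g" using e by (simp add: g_def field_simps)
    moreover have "c 1 = 12 * b * e + 24 * a * e * g - 6 * a ^ 3 + 12 * e" using e by (simp add: b_def field_simps)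
    ultimately have "\<forall>i<4. \<phi> (\<lambda>i. [a, b, g, e] ! i) i = c i"
      unfolding less_4 by (auto simp: \<phi>_def eval_nat_numeral)
    then show "\<exists>z. \<forall>i<4. \<phi> z i = c i" by blast
  qed (simp_all add: alg_intros alg_coord)
qed

lemma alg_insert_remainder:
  assumes "f \<in> alg (insert h X)"
  shows "\<exists>A\<in>alg (insert h X). \<exists>B\<in>alg X. \<forall>x. f x = h x * A x + B x"
  using assms
proof (induction rule: alg_induct)
  case (gen g)
  then show ?case
  proof
    assume "g = h"
    then show ?thesis
      by (intro bexI[of _ "\<lambda>_. 1"] bexI[of _ "\<lambda>_. 0"]) (simp_all add: alg_const)
  next
    assume "g \<in> X"
    then show ?thesis
      by (intro bexI[of _ "\<lambda>_. 0"] bexI[of _ g]) (simp_all add: alg_const alg_gen)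
  qed
next
  case (const c)
  show ?case by (intro bexI[of _ "\<lambda>_. 0"] bexI[of _ "\<lambda>_. c"]) (simp_all add: alg_const)
next
  case (add f g)
  then obtain A B A' B' where A: "A \<in> alg (insert h X)" "A' \<in> alg (insert h X)"
    and B: "B \<in> alg X" "B' \<in> alg X"
    and eq: "\<forall>x. f x = h x * A x + B x" "\<forall>x. g x = h x * A' x + B' x" by blast
  show ?case
    by (rule rev_bexI[OF alg_add[OF A]], rule rev_bexI[OF alg_add[OF B]])
       (simp add: eq algebra_simps)
next
  case (mult f g)
  then obtain A B A' B' where A: "A' \<in> alg (insert h X)" and B: "B \<in> alg X" "B' \<in> alg X"
    and eq: "\<forall>x. f x = h x * A x + B x" "\<forall>x. g x = h x * A' x + B' x"
    and A0: "A \<in> alg (insert h X)" by blast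
  have "B \<in> alg (insert h X)"
    using B(1) alg_subset[of X "insert h X"] alg_gen by blast
  then have 1: "(\<lambda>x. A x * g x + B x * A' x) \<in> alg (insert h X)"
    by (intro alg_add alg_mult A A0 mult.hyps)
  show ?case
    by (rule rev_bexI[OF 1], rule rev_bexI[OF alg_mult[OF B]]) (simp add: eq algebra_simps)
qed

lemma mult_diff_eq_zero:
  fixes a b e e' :: complex
  assumes "a + b * e = 0" "a + b * e' = 0"
  shows "b * (e - e') = 0"
  using assms by algebra

text \<open>On the hypersurface \<open>axis_norm = 0\<close> the remainders of \<open>A\<close> and \<open>B\<close> modulo \<^const>\<open>axis_norm\<close>
  vanish, since \<open>E6\<close> separates points with equal values of the other invariants there.\<close>

lemma axis_norm_cancel:
  assumes f: "f \<in> S3" and AB: "A \<in> S3_dagger" "B \<in> S3_dagger"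
    and eq: "\<And>x. axis_norm x ^ Suc j * f x = A x + B x * E6 x"
  obtains A' B' where "A' \<in> S3_dagger" "B' \<in> S3_dagger"
    "\<And>x. axis_norm x ^ j * f x = A' x + B' x * E6 x"
proof -
  let ?Y = "set [E1, E3, E4, E5]"
  have sub: "S3_dagger \<subseteq> alg (insert axis_norm ?Y)"
    unfolding S3_dagger_def
  proof (rule alg_subset)
    have "E2 = (\<lambda>x. E1 x + 4 * axis_norm x)" by (simp add: axis_norm_def field_simps)
    moreover have "(\<lambda>x. E1 x + 4 * axis_norm x) \<in> alg (insert axis_norm ?Y)"
      by (intro alg_add alg_mult alg_const alg_gen) simp_all
    ultimately show "{E1, E2, E3, E4, E5} \<subseteq> alg (insert axis_norm ?Y)"
      by (auto intro: alg_gen)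
  qed
  have sub': "alg (insert axis_norm ?Y) \<subseteq> S3_dagger"
    unfolding S3_dagger_def
    by (rule alg_subset) (use axis_norm_dagger dagger_E in \<open>auto simp: S3_dagger_def\<close>)
  obtain A1 A0 where A: "A1 \<in> S3_dagger" "A0 \<in> alg ?Y" "\<And>x. A x = axis_norm x * A1 x + A0 x"
    using alg_insert_remainder[of A axis_norm ?Y] AB(1) sub sub' by blast
  obtain B1 B0 where B: "B1 \<in> S3_dagger" "B0 \<in> alg ?Y" "\<And>x. B x = axis_norm x * B1 x + B0 x"
    using alg_insert_remainder[of B axis_norm ?Y] AB(2) sub sub' by blast
  obtain P where P: "P \<in> alg (coords 4)" "\<And>x. A0 x = P (\<lambda>i. ([E1, E3, E4, E5] ! i) x)"
    by (rule alg_set_rep[OF A(2), of 4], simp, rule that)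
  obtain Q where Q: "Q \<in> alg (coords 4)" "\<And>x. B0 x = Q (\<lambda>i. ([E1, E3, E4, E5] ! i) x)"
    by (rule alg_set_rep[OF B(2), of 4], simp, rule that)
  have iso0: "A0 (isotropic a b g e) + B0 (isotropic a b g e) * E6 (isotropic a b g e) = 0" for a b g e
  proof -
    have "axis_norm (isotropic a b g e) = 0" by (simp add: axis_norm_def E_isotropic)
    then show ?thesis using eq[of "isotropic a b g e"] by (simp add: A(3) B(3))
  qed
  have iso_neg: "(\<lambda>i. ([E1, E3, E4, E5] ! i) (isotropic a (- b) g e)) j = (\<lambda>i. ([E1, E3, E4, E5] ! i) (isotropic a b g e)) j"
    if "j < 4" for a b g e j
  proof -
    from that have "j = 0 \<or> j = 1 \<or> j = 2 \<or> j = 3" by auto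
    then show ?thesis by (elim disjE) (simp_all add: E_isotropic)
  qed
  have B0: "B0 (isotropic a b g e) = 0" if "b \<noteq> 0" "e \<noteq> 0" for a b g e
  proof -
    have "A0 (isotropic a (- b) g e) = A0 (isotropic a b g e)" "B0 (isotropic a (- b) g e) = B0 (isotropic a b g e)"
      unfolding P(2) Q(2) by (rule alg_coords_cong[OF P(1) iso_neg], assumption,
        rule alg_coords_cong[OF Q(1) iso_neg], assumption)
    then have "A0 (isotropic a b g e) + B0 (isotropic a b g e) * E6 (isotropic a (- b) g e) = 0"
      using iso0[of a "- b" g e] by simp
    from mult_diff_eq_zero[OF this iso0[of a b g e]]
    have "B0 (isotropic a b g e) * (E6 (isotropic a (- b) g e) - E6 (isotropic a b g e)) = 0" .
    then show ?thesis using that by (simp add: E_isotropic(6))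
  qed
  have Q0: "Q c = 0" for c
    by (rule isotropic_dominant[OF Q(1)]) (simp add: B0 flip: Q(2))
  have P0: "P c = 0" for c
  proof (rule isotropic_dominant[OF P(1)])
    fix a b g e :: complex assume "b \<noteq> 0" "e \<noteq> 0"
    then have "A0 (isotropic a b g e) = 0" using iso0[of a b g e] B0 by simp
    then show "P (\<lambda>i. ([E1, E3, E4, E5] ! i) (isotropic a b g e)) = 0" by (simp flip: P(2))
  qed
  have eq': "axis_norm x * (axis_norm x ^ j * f x - (A1 x + B1 x * E6 x)) = 0" for x
    using eq[of x] by (simp add: A(3) B(3) P(2) Q(2) P0 Q0 algebra_simps)
  have "axis_norm \<in> S3" "(\<lambda>x. axis_norm x ^ j * f x - (A1 x + B1 x * E6 x)) \<in> S3"
    using A(1) B(1) axis_norm_dagger f S3_dagger_subset_S3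
    by (auto intro!: S3_intros intro: E_in_S3)
  then have "axis_norm \<in> alg entries" "(\<lambda>x. axis_norm x ^ j * f x - (A1 x + B1 x * E6 x)) \<in> alg entries"
    by (simp_all add: S3_iff)
  from alg_entries_domain[OF this eq', of "slice (\<lambda>_. 1)"]
  have "axis_norm x ^ j * f x - (A1 x + B1 x * E6 x) = 0" for x by (simp add: axis_norm_slice)
  then show ?thesis using that[OF A(1) B(1)] by simp
qed

lemma S3_decomp:
  assumes "f \<in> S3"
  obtains A B where "A \<in> S3_dagger" "B \<in> S3_dagger" "\<And>x. f x = A x + B x * E6 x"
proof -
  have descent: "\<exists>A\<in>S3_dagger. \<exists>B\<in>S3_dagger. \<forall>x. f x = A x + B x * E6 x"
    if "A \<in> S3_dagger" "B \<in> S3_dagger" "\<And>x. axis_norm x ^ j * f x = A x + B x * E6 x" for A B j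
    using that
  proof (induction j arbitrary: A B)
    case 0
    then show ?case by auto
  next
    case (Suc j)
    obtain A' B' where "A' \<in> S3_dagger" "B' \<in> S3_dagger"
      "\<And>x. axis_norm x ^ j * f x = A' x + B' x * E6 x"
      by (rule axis_norm_cancel[OF assms Suc.prems], rule that)
    then show ?case by (rule Suc.IH)
  qed
  obtain j A B where "A \<in> S3_dagger" "B \<in> S3_dagger"
    "\<And>x. axis_norm x ^ j * f x = A x + B x * E6 x"
    by (rule S3_axis_norm_power_decomp[OF assms], rule that)
  then show ?thesis using descent that by metis
qed


section \<open>Independence, freeness and integrality\<close>

text \<open>On the slice \<open>E1, \<dots>, E5\<close> are polynomials in the five functions of \<^const>\<open>slice_gens\<close>, and for
  \<open>E1 \<noteq> E2\<close> these can be solved for.\<close>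

lemma E_dominant:
  assumes P: "P \<in> alg (coords 5)"
    and zero: "\<And>x. P (\<lambda>i. ([E1, E2, E3, E4, E5] ! i) x) = 0"
  shows "P c = 0"
proof -
  define \<phi> :: "(nat \<Rightarrow> complex) \<Rightarrow> nat \<Rightarrow> complex" where
    "\<phi> z i = (let s = 2 * z 3 + 2 * z 2 + 3/2 * (z 1)\<^sup>2;
        t = 3 * z 4 - 3 * z 1 * z 3 + 3/2 * z 1 * z 2 + 3/4 * z 1 ^ 3 in
      [s - 2 * z 0, s + 2 * z 0, t + 3 * z 0 * z 1, t - z 0 * z 1,
       (s - 2 * z 0)\<^sup>2 / 2 + 4 * z 0 * ((z 1)\<^sup>2 + z 2)] ! i)" for z i
  have less_5: "i < 5 \<longleftrightarrow> i = 0 \<or> i = 1 \<or> i = 2 \<or> i = 3 \<or> i = 4" for i :: nat by auto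
  show ?thesis
  proof (rule alg_coords_zero_of_dominant[OF P, of \<phi> "\<lambda>z. z 2 * z 3" "\<lambda>_. 1" "\<lambda>c. c 1 - c 0"
      "\<lambda>i. if i = 1 then 1 else 0"])
    fix i :: nat assume "i < 5"
    then show "(\<lambda>z. \<phi> z i) \<in> alg (coords 5)"
      unfolding less_5 \<phi>_def Let_def
      by (elim disjE) (simp_all add: alg_intros alg_coord)
  next
    fix z :: "nat \<Rightarrow> complex" assume z: "z 2 * z 3 \<noteq> 0"
    \<comment> \<open>A slice point with \<open>c 2 = 1\<close>; the coordinate \<open>c 5\<close> solves a quadratic equation.\<close>
    define X where "X = z 4 + csqrt ((z 4)\<^sup>2 - (z 2)\<^sup>2 * z 3)"
    have X: "X\<^sup>2 + (z 2)\<^sup>2 * z 3 = 2 * z 4 * X"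
    proof -
      have "(X - z 4)\<^sup>2 = (z 4)\<^sup>2 - (z 2)\<^sup>2 * z 3" by (simp add: X_def)
      then show ?thesis by algebra
    qed
    with z have X0: "X \<noteq> 0" by auto
    define c where "c = (\<lambda>i. [csqrt (z 0), z 1, 1, z 2, z 3 / X, X] ! i)"
    have "slice_w c = (X\<^sup>2 + (z 2)\<^sup>2 * z 3) / (2 * X)"
      using X0 by (simp add: slice_w_def c_def eval_nat_numeral field_simps)
    then have w: "slice_w c = z 4" using X0 unfolding X by simp
    have c: "c 0 ^ 2 = z 0" "c 1 = z 1" "c 2 * c 3 = z 2" "c 4 * c 5 = z 3"
      using X0 by (simp_all add: c_def)
    have "P (\<phi> z) = P (\<lambda>i. ([E1, E2, E3, E4, E5] ! i) (slice c))"
      by (rule alg_coords_cong[OF P])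
         (unfold less_5 \<phi>_def Let_def, elim disjE,
          simp_all add: E_slice c[unfolded One_nat_def] w)
    then show "P (\<phi> z) = 0" using zero by simp
  next
    fix c :: "nat \<Rightarrow> complex" assume c: "c 1 - c 0 \<noteq> 0"
    define h where "h = (c 1 - c 0) / 4"
    define a where "a = (c 2 - c 3) / (4 * h)"
    define n where "n = (c 4 - (c 0)\<^sup>2 / 2) / (4 * h) - a\<^sup>2"
    define k where "k = (c 0 + c 1 - 4 * n - 3 * a\<^sup>2) / 4"
    define w where "w = (c 3 + h * a + 3 * a * k - 3/2 * a * n - 3/4 * a ^ 3) / 3"
    have h: "h \<noteq> 0" using c by (simp add: h_def)
    have s: "2 * k + 2 * n + 3 * a\<^sup>2 / 2 = c 0 + 2 * h" by (simp add: k_def h_def field_simps)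
    have t: "3 * w - 3 * a * k + 3 * a * n / 2 + 3 * a ^ 3 / 4 = c 3 + h * a"
      by (simp add: w_def field_simps)
    have c1: "c 1 = c 0 + 4 * h" by (simp add: h_def field_simps)
    have c2: "c 2 = c 3 + 4 * (h * a)" using h by (simp add: a_def field_simps)
    have "4 * h * (a\<^sup>2 + n) = c 4 - (c 0)\<^sup>2 / 2" using h by (simp add: n_def)
    then have c4: "(c 0)\<^sup>2 / 2 + 4 * h * (a\<^sup>2 + n) = c 4" by simp
    have "\<phi> (\<lambda>i. [h, a, n, k, w] ! i) i = c i" if "i < 5" for i
    proof -
      have "\<phi> (\<lambda>i. [h, a, n, k, w] ! i) i = [c 0, c 0 + 4 * h, c 3 + 4 * (h * a), c 3,
          (c 0)\<^sup>2 / 2 + 4 * h * (a\<^sup>2 + n)] ! i"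
        by (simp add: \<phi>_def Let_def s t) (simp add: algebra_simps)
      then show ?thesis using that unfolding less_5 c4 using c1 c2 by auto
    qed
    then show "\<exists>z. \<forall>i<5. \<phi> z i = c i" by blast
  qed (simp_all add: alg_intros alg_coord)
qed

lemma E_algebraically_independent: "algebraically_independent [E1, E2, E3, E4, E5]"
  unfolding algebraically_independent_def
proof (intro allI impI)
  fix p :: "nat mpoly"
  assume vars: "mvars p \<subseteq> {..<length [E1, E2, E3, E4, E5]}"
    and zero: "\<forall>x. meval (\<lambda>i. ([E1, E2, E3, E4, E5] ! i) x) p = 0"
  have "i < 5" if "m \<in> Poly_Mapping.keys p" "i \<in> Poly_Mapping.keys m" for m i
    using vars that unfolding mvars_def by auto
  then have "(\<lambda>v. meval v p) \<in> alg (coords 5)"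
    unfolding meval_def by (intro alg_sum alg_mult alg_prod alg_power alg_const alg_coord) auto
  from E_dominant[OF this] zero have "meval v p = 0" for v by blast
  with vars show "p = 0" by (rule meval_eq_zero_imp_zero)
qed

text \<open>Together with \<open>A + B E6 = 0\<close>, the conclusion \<open>B = 0\<close> also gives \<open>A = 0\<close>.\<close>

lemma E6_independent:
  assumes AB: "A \<in> S3_dagger" "B \<in> S3_dagger" and eq: "\<And>x. A x + B x * E6 x = 0"
  shows "B x = 0"
proof -
  obtain P where P: "P \<in> alg (coords 5)" "\<And>x. A x = P (\<lambda>i. ([E1, E2, E3, E4, E5] ! i) x)"
    by (rule alg_set_rep[of A "[E1, E2, E3, E4, E5]" 5])
       (use AB(1) in \<open>simp add: S3_dagger_def\<close>, simp, rule that)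
  obtain Q where Q: "Q \<in> alg (coords 5)" "\<And>x. B x = Q (\<lambda>i. ([E1, E2, E3, E4, E5] ! i) x)"
    by (rule alg_set_rep[of B "[E1, E2, E3, E4, E5]" 5])
       (use AB(2) in \<open>simp add: S3_dagger_def\<close>, simp, rule that)
  \<comment> \<open>Reversing the axis changes only the sign of the last term of \<open>E6\<close>.\<close>
  have "B (slice c) * (c 0 ^ 3 * slice_d c) = 0" for c
  proof -
    define c' where "c' = c(0 := - c 0)"
    have w: "slice_w c' = slice_w c" "slice_d c' = slice_d c"
      by (simp_all add: c'_def slice_w_def slice_d_def)
    have E: "E1 (slice c') = E1 (slice c)" "E2 (slice c') = E2 (slice c)" "E3 (slice c') = E3 (slice c)"
      "E4 (slice c') = E4 (slice c)"
      by (simp_all add: E_slice w) (simp_all add: c'_def)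
    moreover have "E5 (slice c') = E5 (slice c)"
      unfolding E_slice(5) E by (simp add: c'_def)
    ultimately have "A (slice c') = A (slice c)" "B (slice c') = B (slice c)"
      unfolding P(2) Q(2)
      by (auto intro!: alg_coords_cong[OF P(1)] alg_coords_cong[OF Q(1)] simp: less_Suc_eq eval_nat_numeral)
    moreover have "E6 (slice c) - E6 (slice c') = 8 * \<i> * (c 0 ^ 3 * slice_d c)"
      unfolding E_slice(6) E \<open>E5 (slice c') = _\<close> w by (simp add: c'_def)
    ultimately have "B (slice c) * (8 * \<i> * (c 0 ^ 3 * slice_d c)) = 0"
      using mult_diff_eq_zero[OF eq[of "slice c"], of "E6 (slice c')"] eq[of "slice c'"] by simp
    then show ?thesis by auto
  qed
  then have zero: "(c 0 ^ 3 * slice_d c) * B (slice c) = 0" for c by (simp add: mult.commute)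
  have d: "(\<lambda>c. c 0 ^ 3 * slice_d c) \<in> alg (coords 6)"
    unfolding slice_d_def by (intro alg_intros alg_coord) simp_all
  have B: "B \<in> S3" using AB(2) S3_dagger_subset_S3 by blast
  then have "(\<lambda>c. B (slice c)) \<in> alg (coords 6)" by (intro alg_slice) (simp add: S3_iff)
  from alg_coords_domain[OF d this zero, of "\<lambda>i. if i = 3 then 0 else 1"]
  have "B (slice c) = 0" for c by (simp add: slice_d_def)
  then show ?thesis using S3_eq_zero_if_zero_on_slice[OF B] by blast
qed

lemma S3_integral:
  assumes "f \<in> S3"
  shows "integral_over S3_dagger f"
proof -
  obtain A B where AB: "A \<in> S3_dagger" "B \<in> S3_dagger" and f: "\<And>x. f x = A x + B x * E6 x"
    by (rule S3_decomp[OF assms], rule that)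
  have E6_sq: "(\<lambda>x. E6 x * E6 x) \<in> S3" by (intro S3_intros E_in_S3)
  obtain C D where CD: "C \<in> S3_dagger" "D \<in> S3_dagger" and E6: "\<And>x. E6 x * E6 x = C x + D x * E6 x"
    by (rule S3_decomp[OF E6_sq], rule that)
  \<comment> \<open>The quadratic equation of \<open>f = A + B E6\<close> that results from \<open>E6\<^sup>2 = C + D E6\<close>.\<close>
  define p0 where "p0 = (\<lambda>x. A x * A x + A x * B x * D x - B x * B x * C x)"
  define p1 where "p1 = (\<lambda>x. - (2 * A x + B x * D x))"
  have p: "p0 \<in> S3_dagger" "p1 \<in> S3_dagger"
    unfolding p0_def p1_def by (intro dagger_intros AB CD)+
  have const: "0 \<in> S3_dagger" "1 \<in> S3_dagger"
    using dagger_intros(1)[of 0] dagger_intros(1)[of 1] by (simp_all add: zero_fun_def one_fun_def)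
  have "p0 x + f x * (p1 x + f x) = 0" for x
  proof -
    have "p0 x + f x * (p1 x + f x) = B x * B x * (E6 x * E6 x - C x - D x * E6 x)"
      unfolding p0_def p1_def f by (simp add: algebra_simps)
    then show ?thesis by (simp add: E6)
  qed
  then have "poly [:p0, p1, 1:] f = 0" by (simp add: fun_eq_iff)
  moreover have "coeff [:p0, p1, 1:] i \<in> S3_dagger" for i
    using p const by (auto simp: coeff_pCons split: nat.split)
  moreover have "lead_coeff [:p0, p1, 1:] = 1" by simp
  ultimately show ?thesis unfolding integral_over_def by blast
qed

theorem theorem2p3:
  shows "homogeneous_system_of_parameters S3 [E1, E2, E3, E4, E5] \<and>
         free_module_basis S3_dagger S3 [1, E6]"
proof
  show "homogeneous_system_of_parameters S3 [E1, E2, E3, E4, E5]"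
    unfolding homogeneous_system_of_parameters_def
    using E_in_S3 E_homogeneous E_algebraically_independent S3_integral
    by (simp add: S3_dagger_def)
next
  have sum: "(\<Sum>i<length [1, E6]. c i * [1, E6] ! i) = (\<lambda>x. c 0 x + c 1 x * E6 x)"
    for c :: "nat \<Rightarrow> traceless \<Rightarrow> complex"
    by (simp add: numeral_2_eq_2 fun_eq_iff)
  show "free_module_basis S3_dagger S3 [1, E6]"
    unfolding free_module_basis_def sum
  proof (intro conjI allI impI subset_antisym subsetI)
    fix f assume "f \<in> S3"
    obtain A B where "A \<in> S3_dagger" "B \<in> S3_dagger" and f: "\<And>x. f x = A x + B x * E6 x"
      by (rule S3_decomp[OF \<open>f \<in> S3\<close>], rule that)
    then show "f \<in> {\<lambda>x. c 0 x + c 1 x * E6 x | c. \<forall>i<length [1, E6]. c i \<in> S3_dagger}"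
      by (intro CollectI exI[of _ "\<lambda>i. if i = 0 then A else B"]) auto
  next
    fix f assume "f \<in> {\<lambda>x. c 0 x + c 1 x * E6 x | c. \<forall>i<length [1, E6]. c i \<in> S3_dagger}"
    then obtain c where f: "f = (\<lambda>x. c 0 x + c 1 x * E6 x)"
      and c: "\<forall>i<length [1, E6]. c i \<in> S3_dagger" by blast
    from c have "c 0 \<in> S3_dagger" "c 1 \<in> S3_dagger" by auto
    then have "c 0 \<in> S3" "c 1 \<in> S3" using S3_dagger_subset_S3 by blast+
    then show "f \<in> S3" unfolding f by (intro S3_intros E_in_S3)
  next
    fix c :: "nat \<Rightarrow> traceless \<Rightarrow> complex" and i
    assume c: "\<forall>i<length [1, E6]. c i \<in> S3_dagger" and i: "i < length [1, E6]"
      and "(\<lambda>x. c 0 x + c 1 x * E6 x) = 0"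
    then have eq: "c 0 x + c 1 x * E6 x = 0" for x by (simp add: fun_eq_iff)
    have "c 0 \<in> S3_dagger" "c 1 \<in> S3_dagger" using c by auto
    from E6_independent[OF this eq] have c1: "c 1 x = 0" for x .
    then have "c 0 x = 0" for x using eq[of x] by simp
    with c1 show "c i = 0" using i by (auto simp: fun_eq_iff less_Suc_eq)
  qed
qed

end
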